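(* For every constant $\epsilon>0$: for every sufficiently large $n$ there is a cardinality bound $k=k(n)$ such that, for every distribution $\mathcal D$ on $2^N$ (where $|N|=n$), the class of coverage functions on $N$ is not $n^{-1/5+\epsilon}$-optimizable from samples over $\mathcal D$ under the constraint $\{S\subseteq N:|S|\le k\}$. In addition, there is a cardinality bound $k=k(n)$ such that, for every distribution $\mathcal D$, the class of polynomial-sized coverage functions on $N$ is not $2^{-\Omega(\sqrt{\log n})}$-optimizable from samples over $\mathcal D$ under the constraint $\{S\subseteq N:|S|\le k\}$.
   Context: Let $N$ be a ground set with $n=|N|$. A function $f:2^N\to\mathbb R$ is a coverage function if there is a finite set $U$ of "children" with nonnegative weights $w(a)$, $a\in U$, and sets $T_e\subseteq U$ for $e\in N$, such that $f(S)=\sum_{a\in\bigcup_{e\in S}T_e}w(a)$ for all $S\subseteq N$. It is polynomial-sized if $|U|$ is polynomial in $n$. Optimization from samples: a class $\mathcal F$ of functions $2^N\to\mathbb R$ is $\alpha$-optimizable from samples over a distribution $\mathcal D$ on $2^N$ under the constraint $\mathcal M=\{S:|S|\le k\}$ if there exists a (not necessarily polynomial-time, possibly randomized) algorithm which, for every $f\in\mathcal F$, given as input $m\in\mathrm{poly}(n)$ pairs $(S_i,f(S_i))_{i=1}^m$ with $S_1,\dots,S_m$ drawn i.i.d. from $\mathcal D$, returns a set $S\in\mathcal M$ such that $\Pr_{S_1,\dots,S_m\sim\mathcal D}\big[\mathbb E[f(S)]\ge\alpha\max_{T\in\mathcal M}f(T)\big]\ge 1-\delta$, where the expectation is over the algorithm's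 randomness and $\delta\in[0,1)$ is a constant. All statements are asymptotic in $n$. *)

theory Defs
  imports "HOL-Probability.Probability"
begin

definition ground :: "nat \<Rightarrow> nat set" where
  "ground n = {..<n}"

definition coverage_with :: "nat \<Rightarrow> (nat \<Rightarrow> bool) \<Rightarrow> (nat set \<Rightarrow> real) \<Rightarrow> bool" where
  "coverage_with n P f \<longleftrightarrow>
     (\<exists>(U::nat set) (w::nat \<Rightarrow> real) (T::nat \<Rightarrow> nat set).
        finite U \<and> P (card U) \<and> (\<forall>a\<in>U. 0 \<le> w a) \<and> (\<forall>e\<in>ground n. T e \<subseteq> U) \<and>
        (\<forall>S. S \<subseteq> ground n \<longrightarrow> f S = (\<Sum>a\<in>(\<Union>e\<in>S. T e). w a)))"

definition coverage_functions :: "nat \<Rightarrow> (nat set \<Rightarrow> real) set" where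
  "coverage_functions n = {f. coverage_with n (\<lambda>_. True) f}"

definition poly_coverage_functions :: "nat \<Rightarrow> nat \<Rightarrow> (nat set \<Rightarrow> real) set" where
  "poly_coverage_functions d n = {f. coverage_with n (\<lambda>u. u \<le> n ^ d) f}"

definition card_constraint :: "nat \<Rightarrow> nat \<Rightarrow> nat set set" where
  "card_constraint n k = {S. S \<subseteq> ground n \<and> card S \<le> k}"

text \<open>For fixed n, sample count m and failure probability \<delta>: the class F is
  \<alpha>-optimizable from m samples over D under the cardinality constraint k.
  A (randomized, unrestricted) algorithm maps the list of samples (S_i, f S_i)
  to a distribution over feasible sets.\<close>
definition optimizable_from_samples ::
  "nat \<Rightarrow> (nat set \<Rightarrow> real) set \<Rightarrow> nat set pmf \<Rightarrow> nat \<Rightarrow> real \<Rightarrow> nat \<Rightarrow> real \<Rightarrow> bool" where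
  "optimizable_from_samples n F D k \<alpha> m \<delta> \<longleftrightarrow>
     (\<exists>A :: (nat set \<times> real) list \<Rightarrow> nat set pmf.
        (\<forall>xs. set_pmf (A xs) \<subseteq> card_constraint n k) \<and>
        (\<forall>f\<in>F.
           measure_pmf.prob (replicate_pmf m D)
             {Ss. measure_pmf.expectation (A (map (\<lambda>S. (S, f S)) Ss)) f
                  \<ge> \<alpha> * Max (f ` card_constraint n k)} \<ge> 1 - \<delta>))"

end

theory Submission
  imports Defs "HOL-Real_Asymp.Real_Asymp"
begin

text \<open>
  Hide one of \<open>r\<close> disjoint parts of size \<open>k\<close> at random positions of the ground set. On its part, the
  hidden (good) part has a coverage function \<open>g\<close> with \<open>g(S) \<ge> |S|\<close>, whereas every other (bad) part has a
  coverage function \<open>b\<close> bounded by a constant; nevertheless \<open>g = b\<close> on all sets of size at most \<open>l\<close>.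
  Such a pair exists because \<open>y \<mapsto> y\<close> agrees for \<open>y \<le> l\<close> with a linear combination of functions
  \<open>1 - (1 - p)^y\<close>, the coverage functions of random subsets of density \<open>p\<close>; the negative coefficients
  are moved to the side of \<open>g\<close>. The remaining elements form masking blocks: a set that meets every
  block covers everything. A small set meets each part at most \<open>l\<close> times, a large one meets all
  blocks, so with high probability no sample reveals which part is good, and a guess gains at most
  about \<open>1/r + r/k + k/u\<close> of the optimum, where \<open>u\<close> is the number of blocks. Choosing \<open>r = \<kappa>\<close>,
  \<open>k = \<kappa>^2\<close>, \<open>u = \<kappa>^3\<close> balances the three terms; this needs \<open>\<kappa>^5 \<lless> n\<close>.
\<close>

section \<open>A binomial identity\<close>

text \<open>The \<open>l\<close>-th finite difference annihilates polynomials of degree below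
  \<open>l\<close>. Pascal's rule turns the sum for \<open>Suc l\<close> into the difference of the
  sums \<open>s\<close> at \<open>x\<close> and at \<open>x + y\<close>. Expanding the latter in
  powers of \<open>y\<close>, the term \<open>q = i\<close> cancels and the terms
  \<open>q < i\<close> vanish by induction.\<close>

lemma alternating_binomial_sum_affine:
  fixes x y :: real
  assumes "i < l"
  shows "(\<Sum>j\<le>l. (-1) ^ j * real (l choose j) * (x + real j * y) ^ i) = 0"
  using assms
proof (induction l arbitrary: i x)
  case 0
  then show ?case by simp
next
  case (Suc l)
  define s where "s q z = (\<Sum>j\<le>l. (-1) ^ j * real (l choose j) * (z + real j * y) ^ q)" for q z
  have "(\<Sum>j\<le>Suc l. (-1) ^ j * real (Suc l choose j) * (x + real j * y) ^ i) =
     x ^ i + (\<Sum>j\<le>l. (-1) ^ Suc j * real (Suc l choose Suc j) * (x + real (Suc j) * y) ^ i)"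
    by (subst sum.atMost_Suc_shift) simp
  also have "\<dots> = x ^ i + (\<Sum>j\<le>l. (-1) ^ Suc j * real (l choose Suc j) * (x + real (Suc j) * y) ^ i)
      - s i (x + y)"
  proof -
    have "(-1) ^ Suc j * real (Suc l choose Suc j) * (x + real (Suc j) * y) ^ i =
        (-1) ^ Suc j * real (l choose Suc j) * (x + real (Suc j) * y) ^ i
        - (-1) ^ j * real (l choose j) * (x + y + real j * y) ^ i" for j
    proof -
      have "x + real (Suc j) * y = x + y + real j * y" by (simp add: algebra_simps)
      then show ?thesis by (simp add: algebra_simps)
    qed
    then show ?thesis unfolding s_def by (simp only: sum_subtractf)
  qed
  also have "x ^ i + (\<Sum>j\<le>l. (-1) ^ Suc j * real (l choose Suc j) * (x + real (Suc j) * y) ^ i) =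
      (\<Sum>j\<le>Suc l. (-1) ^ j * real (l choose j) * (x + real j * y) ^ i)"
    by (subst sum.atMost_Suc_shift) simp
  \<comment> \<open>The extra last term vanishes because \<open>l choose Suc l = 0\<close>.\<close>
  also have "\<dots> = s i x" by (simp add: s_def)
  also have "s i (x + y) = (\<Sum>q\<le>i. real (i choose q) * y ^ (i - q) * s q x)"
  proof -
    have "s i (x + y) = (\<Sum>j\<le>l. (-1) ^ j * real (l choose j) * ((x + real j * y) + y) ^ i)"
      unfolding s_def by (intro sum.cong refl arg_cong2[where f = "(*)"] arg_cong2[where f = power]) simp
    also have "\<dots> = (\<Sum>j\<le>l. \<Sum>q\<le>i. real (i choose q) * y ^ (i - q) *
        ((-1) ^ j * real (l choose j) * (x + real j * y) ^ q))"
    proof (intro sum.cong refl)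
      fix j
      have "((x + real j * y) + y) ^ i = (\<Sum>q\<le>i. real (i choose q) * (x + real j * y) ^ q * y ^ (i - q))"
        by (rule binomial_ring)
      then show "(-1) ^ j * real (l choose j) * ((x + real j * y) + y) ^ i =
          (\<Sum>q\<le>i. real (i choose q) * y ^ (i - q) * ((-1) ^ j * real (l choose j) * (x + real j * y) ^ q))"
        by (simp only: sum_distrib_left mult_ac)
    qed
    finally show ?thesis
      unfolding s_def sum_distrib_left by (subst (asm) sum.swap)
  qed
  also have "\<dots> = s i x + (\<Sum>q<i. real (i choose q) * y ^ (i - q) * s q x)"
    by (cases i) (simp_all add: lessThan_Suc_atMost)
  also have "(\<Sum>q<i. real (i choose q) * y ^ (i - q) * s q x) = 0"
    using Suc by (intro sum.neutral) (auto simp: s_def)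
  finally show ?case by simp
qed

text \<open>Dividing \<open>1 - (1 - j p)^y\<close> by \<open>j p\<close> leaves a geometric sum of
  \<open>y\<close> powers, each a polynomial in \<open>j\<close> of degree below \<open>l\<close>.
  The full alternating sum of each power is zero and its omitted term \<open>j = 0\<close> equals 1,
  so every power contributes exactly 1.\<close>

lemma linear_as_geometric_combination:
  fixes p :: real
  assumes "y \<le> l" "p \<noteq> 0"
  shows "(\<Sum>j=1..l. (-1) ^ Suc j * real (l choose j) / (real j * p) * (1 - (1 - real j * p) ^ y)) = real y"
proof -
  have "(\<Sum>j=1..l. (-1) ^ Suc j * real (l choose j) / (real j * p) * (1 - (1 - real j * p) ^ y))
      = (\<Sum>j=1..l. - (\<Sum>i<y. (-1) ^ j * real (l choose j) * (1 + real j * (- p)) ^ i))"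
  proof (intro sum.cong refl)
    fix j assume "j \<in> {1..l}"
    then have "real j * p \<noteq> 0" using assms by simp
    moreover have "1 - (1 - real j * p) ^ y = real j * p * (\<Sum>i<y. (1 - real j * p) ^ i)"
      by (subst one_diff_power_eq) simp
    ultimately show "(-1) ^ Suc j * real (l choose j) / (real j * p) * (1 - (1 - real j * p) ^ y)
      = - (\<Sum>i<y. (-1) ^ j * real (l choose j) * (1 + real j * (- p)) ^ i)"
      by (simp add: sum_distrib_left sum_negf mult_ac)
  qed
  also have "\<dots> = - (\<Sum>i<y. \<Sum>j=1..l. (-1) ^ j * real (l choose j) * (1 + real j * (- p)) ^ i)"
    by (subst sum.swap) (simp add: sum_negf)
  also have "\<dots> = - (\<Sum>i<y. -1)"
  proof (intro arg_cong[where f = uminus] sum.cong refl)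
    fix i assume "i \<in> {..<y}"
    then have "(\<Sum>j\<le>l. (-1) ^ j * real (l choose j) * (1 + real j * (- p)) ^ i) = 0"
      using assms by (intro alternating_binomial_sum_affine) auto
    moreover have "{..l} = insert 0 {1..l}" by auto
    ultimately show "(\<Sum>j=1..l. (-1) ^ j * real (l choose j) * (1 + real j * (- p)) ^ i) = -1"
      by simp
  qed
  finally show ?thesis by simp
qed

section \<open>Sparse conic combinations\<close>

text \<open>Gaussian elimination, one coordinate at a time: a pivot \<open>a0\<close> that is
  nonzero at the new coordinate clears it from the other vectors, and a dependence among these is
  lifted back.\<close>

lemma ex_linear_dependence:
  fixes v :: "'a \<Rightarrow> 'i \<Rightarrow> real"
  assumes "finite X" "finite S" "card X < card S"
  shows "\<exists>c. (\<exists>a\<in>S. c a \<noteq> 0) \<and> (\<forall>x\<in>X. (\<Sum>a\<in>S. c a * v a x) = 0)"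
  using assms
proof (induction X arbitrary: S v rule: finite_induct)
  case empty
  then have "S \<noteq> {}" by auto
  then show ?case by (intro exI[of _ "\<lambda>_. 1"]) auto
next
  case (insert x X)
  show ?case
  proof (cases "\<forall>a\<in>S. v a x = 0")
    case True
    obtain c where "\<exists>a\<in>S. c a \<noteq> 0" "\<forall>y\<in>X. (\<Sum>a\<in>S. c a * v a y) = 0"
      using insert.IH[of S v] insert.prems insert.hyps by auto
    with True show ?thesis by (intro exI[of _ c]) auto
  next
    case False
    then obtain a0 where a0: "a0 \<in> S" "v a0 x \<noteq> 0" by auto
    define S' where "S' = S - {a0}"
    have S: "S = insert a0 S'" "a0 \<notin> S'" "finite S'"
      using a0 insert.prems by (auto simp: S'_def)
    obtain c where c: "\<exists>a\<in>S'. c a \<noteq> 0"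
      "\<And>y. y \<in> X \<Longrightarrow> (\<Sum>a\<in>S'. c a * (v a y - v a x / v a0 x * v a0 y)) = 0"
      using insert.IH[of S' "\<lambda>a y. v a y - v a x / v a0 x * v a0 y"] insert.prems insert.hyps S
      by auto
    \<comment> \<open>Coordinate \<open>x\<close> forces this coefficient of the pivot; at the other
      coordinates it reproduces the dependence of the reduced vectors.\<close>
    define c' where "c' = c(a0 := - (\<Sum>a\<in>S'. c a * v a x) / v a0 x)"
    have sums: "(\<Sum>a\<in>S. c' a * v a y) = c' a0 * v a0 y + (\<Sum>a\<in>S'. c a * v a y)" for y
      using S by (auto simp: c'_def intro!: sum.cong)
    have "(\<Sum>a\<in>S. c' a * v a y) = 0" if "y \<in> insert x X" for y
    proof (cases "y = x")
      case True
      then show ?thesis using a0 by (simp add: sums) (simp add: c'_def)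
    next
      case False
      then have "0 = (\<Sum>a\<in>S'. c a * v a y - c a * v a x * (v a0 y / v a0 x))"
        using c(2)[of y] that by (simp add: algebra_simps)
      also have "\<dots> = (\<Sum>a\<in>S'. c a * v a y) - (\<Sum>a\<in>S'. c a * v a x) * (v a0 y / v a0 x)"
        by (simp only: sum_subtractf sum_distrib_right)
      finally show ?thesis by (simp add: sums) (simp add: c'_def)
    qed
    moreover have "\<exists>a\<in>S. c' a \<noteq> 0"
      using c(1) S by (auto simp: c'_def)
    ultimately show ?thesis by blast
  qed
qed

text \<open>Caratheodory's theorem for cones, by descent on the support. Among more than
  \<open>card X\<close> vectors there is a linear dependence; subtracting a multiple of it keeps all
  coordinates and, at the right multiple, removes one vector without making a weight
  negative.\<close>

lemma conic_caratheodory: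
  fixes v :: "'a \<Rightarrow> 'i \<Rightarrow> real"
  assumes "finite X" "finite S" "\<And>a. a \<in> S \<Longrightarrow> 0 \<le> w a"
  shows "\<exists>w'. (\<forall>a\<in>S. 0 \<le> w' a) \<and> card {a\<in>S. w' a \<noteq> 0} \<le> card X \<and>
     (\<forall>x\<in>X. (\<Sum>a\<in>S. w' a * v a x) = (\<Sum>a\<in>S. w a * v a x))"
  using assms(3)
proof (induction "card {a\<in>S. w a \<noteq> 0}" arbitrary: w rule: less_induct)
  case less
  define R where "R = {a\<in>S. w a \<noteq> 0}"
  show ?case
  proof (cases "card R \<le> card X")
    case True
    with less.prems show ?thesis by (auto simp: R_def)
  next
    case False
    have R: "finite R" "R \<subseteq> S" using assms by (auto simp: R_def)
    obtain c0 where c0: "\<exists>a\<in>R. c0 a \<noteq> 0" "\<And>x. x \<in> X \<Longrightarrow> (\<Sum>a\<in>R. c0 a * v a x) = 0"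
      using ex_linear_dependence[OF assms(1) R(1), of v] False by auto
    obtain a1 where a1: "a1 \<in> R" "c0 a1 \<noteq> 0" using c0 by auto
    \<comment> \<open>Dividing by \<open>c0 a1\<close> makes the coefficient at \<open>a1\<close>
      equal to 1, so that some coefficient is positive and \<open>P\<close> below is
      nonempty.\<close>
    define c where "c a = (if a \<in> R then c0 a / c0 a1 else 0)" for a
    have c: "c a1 = 1" "\<And>x. x \<in> X \<Longrightarrow> (\<Sum>a\<in>S. c a * v a x) = 0" "\<And>a. a \<notin> R \<Longrightarrow> c a = 0"
    proof -
      fix x assume x: "x \<in> X"
      have "(\<Sum>a\<in>S. c a * v a x) = (\<Sum>a\<in>R. c a * v a x)"
        using R assms by (intro sum.mono_neutral_right) (auto simp: c_def)
      also have "\<dots> = (\<Sum>a\<in>R. c0 a * v a x) / c0 a1"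
        by (simp add: c_def sum_divide_distrib)
      finally show "(\<Sum>a\<in>S. c a * v a x) = 0" using c0(2)[OF x] by simp
    qed (use a1 in \<open>auto simp: c_def\<close>)
    define P where "P = {a\<in>R. c a > 0}"
    have P: "finite P" "P \<noteq> {}" using a1 c R by (auto simp: P_def intro!: exI[of _ a1])
    \<comment> \<open>The largest multiple of \<open>c\<close> that can be subtracted from
      nonnegative weights; a minimiser \<open>a2\<close> leaves the support.\<close>
    define t where "t = Min ((\<lambda>a. w a / c a) ` P)"
    have "t \<in> (\<lambda>a. w a / c a) ` P" unfolding t_def using P by (intro Min_in) auto
    then obtain a2 where a2: "a2 \<in> P" "t = w a2 / c a2" by auto
    have tle: "t \<le> w a / c a" if "a \<in> P" for a
      unfolding t_def using that P by (intro Min_le) auto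
    have t0: "0 \<le> t" using a2 less.prems R by (auto simp: P_def)
    define w' where "w' a = w a - t * c a" for a
    have nonneg: "0 \<le> w' a" if "a \<in> S" for a
    proof (cases "a \<in> P")
      case True
      then show ?thesis using tle[OF True] by (simp add: w'_def P_def field_simps)
    next
      case False
      then have "c a \<le> 0" using c(3)[of a] by (auto simp: P_def not_less)
      then have "t * c a \<le> 0" using t0 by (simp add: mult_nonneg_nonpos)
      then show ?thesis using less.prems[OF that] by (simp add: w'_def)
    qed
    have "w' a2 = 0" "a2 \<in> R" using a2 by (auto simp: w'_def P_def)
    then have "{a\<in>S. w' a \<noteq> 0} \<subseteq> R - {a2}"
      using c(3) by (auto simp: w'_def R_def)
    then have "card {a\<in>S. w' a \<noteq> 0} < card R"
      using R \<open>a2 \<in> R\<close> by (intro psubset_card_mono) auto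
    then have "\<exists>w''. (\<forall>a\<in>S. 0 \<le> w'' a) \<and> card {a\<in>S. w'' a \<noteq> 0} \<le> card X \<and>
       (\<forall>x\<in>X. (\<Sum>a\<in>S. w'' a * v a x) = (\<Sum>a\<in>S. w' a * v a x))"
      using less.hyps[of w'] nonneg by (simp add: R_def)
    moreover have "(\<Sum>a\<in>S. w' a * v a x) = (\<Sum>a\<in>S. w a * v a x)" if "x \<in> X" for x
    proof -
      have "(\<Sum>a\<in>S. w' a * v a x) = (\<Sum>a\<in>S. w a * v a x) - t * (\<Sum>a\<in>S. c a * v a x)"
        by (simp add: w'_def algebra_simps sum_subtractf sum_distrib_left)
      then show ?thesis using c(2)[OF that] by simp
    qed
    ultimately show ?thesis by auto
  qed
qed

text \<open>A set of at most \<open>l\<close> elements is read off a word of length \<open>l\<close>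
  over \<open>T\<close> and the padding symbol \<open>None\<close>.\<close>

lemma card_bounded_subsets_le:
  assumes "finite T"
  shows "card {X. X \<subseteq> T \<and> card X \<le> l} \<le> (card T + 1) ^ l"
proof -
  define T' where "T' = insert None (Some ` T)"
  have T': "finite T'" "card T' = card T + 1"
    using assms by (auto simp: T'_def card_insert_if card_image)
  define L where "L = {xs. set xs \<subseteq> T' \<and> length xs = l}"
  have L: "finite L" "card L = (card T + 1) ^ l"
    unfolding L_def using T' by (simp_all add: finite_lists_length_eq card_lists_length_eq)
  have "{X. X \<subseteq> T \<and> card X \<le> l} \<subseteq> (\<lambda>xs. {x. Some x \<in> set xs}) ` L"
  proof
    fix X assume "X \<in> {X. X \<subseteq> T \<and> card X \<le> l}"
    then have X: "X \<subseteq> T" "card X \<le> l" by auto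
    obtain ys where ys: "set ys = X" "distinct ys"
      using finite_distinct_list[OF finite_subset[OF X(1) assms]] by blast
    then have le: "length ys \<le> l" using X distinct_card[of ys] by simp
    define xs where "xs = map Some ys @ replicate (l - length ys) None"
    have "xs \<in> L"
      using X(1) ys(1) le unfolding xs_def T'_def L_def by (auto split: if_splits)
    moreover have "X = {x. Some x \<in> set xs}"
      unfolding xs_def using ys(1) by auto
    ultimately show "X \<in> (\<lambda>xs. {x. Some x \<in> set xs}) ` L" by blast
  qed
  then have "card {X. X \<subseteq> T \<and> card X \<le> l} \<le> card L"
    using L(1) by (rule surj_card_le[rotated])
  with L(2) show ?thesis by simp
qed

section \<open>Good and bad coverage functions\<close>

text \<open>A coverage function in canonical form: the children are the subsets of \<open>T\<close>,
  and an element covers exactly the subsets that contain it.\<close>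

definition cov :: "'a set \<Rightarrow> ('a set \<Rightarrow> real) \<Rightarrow> 'a set \<Rightarrow> real" where
  "cov T w X = (\<Sum>A\<in>Pow T. w A * of_bool (A \<inter> X \<noteq> {}))"

text \<open>For \<open>A\<close> inside a finite \<open>T\<close> and \<open>p\<close> in the unit
  interval, the probability that the random subset of \<open>T\<close> which keeps each element
  independently with probability \<open>p\<close> equals \<open>A\<close>.\<close>

definition bernoulli_weight :: "'a set \<Rightarrow> real \<Rightarrow> 'a set \<Rightarrow> real" where
  "bernoulli_weight T p A = p ^ card A * (1 - p) ^ card (T - A)"

lemma cov_mono:
  assumes "\<And>A. A \<subseteq> T \<Longrightarrow> 0 \<le> w A" "X \<subseteq> Y"
  shows "cov T w X \<le> cov T w Y"
  unfolding cov_def using assms by (intro sum_mono mult_left_mono) auto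

lemma cov_nonneg: "(\<And>A. A \<subseteq> T \<Longrightarrow> 0 \<le> w A) \<Longrightarrow> 0 \<le> cov T w X"
  unfolding cov_def by (intro sum_nonneg) auto

lemma cov_add: "cov T (\<lambda>A. v A + w A) X = cov T v X + cov T w X"
  by (simp add: cov_def sum.distrib distrib_right)

lemma cov_sum: "cov T (\<lambda>A. \<Sum>j\<in>J. c j * w j A) X = (\<Sum>j\<in>J. c j * cov T (w j) X)"
  unfolding cov_def sum_distrib_left sum_distrib_right mult.assoc by (rule sum.swap)

lemma sum_bernoulli_weight:
  assumes "finite T"
  shows "(\<Sum>A\<in>Pow T. bernoulli_weight T p A) = 1"
  using prod_add[OF assms, of "\<lambda>_. p" "\<lambda>_. 1 - p"] by (simp add: bernoulli_weight_def)

text \<open>A random subset of density \<open>p\<close> misses \<open>X\<close> with probability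
  \<open>(1 - p) ^ card X\<close>: the weight of a set disjoint from \<open>X\<close> splits off
  this factor, and the rest sums to 1 over the subsets of \<open>T - X\<close>.\<close>

lemma cov_bernoulli_weight:
  assumes "finite T" "X \<subseteq> T"
  shows "cov T (bernoulli_weight T p) X = 1 - (1 - p) ^ card X"
proof -
  have fin: "finite X" using assms finite_subset by blast
  have miss: "(\<Sum>A\<in>Pow T. bernoulli_weight T p A * of_bool (A \<inter> X = {})) = (1 - p) ^ card X"
  proof -
    have "(\<Sum>A\<in>Pow T. bernoulli_weight T p A * of_bool (A \<inter> X = {}))
        = (\<Sum>A\<in>Pow (T - X). bernoulli_weight T p A)"
      using assms by (intro sum.mono_neutral_cong_right) auto
    also have "\<dots> = (\<Sum>A\<in>Pow (T - X). (1 - p) ^ card X * bernoulli_weight (T - X) p A)"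
    proof (intro sum.cong refl)
      fix A assume "A \<in> Pow (T - X)"
      then have "T - A = X \<union> (T - X - A)" "X \<inter> (T - X - A) = {}" using assms by auto
      then have "card (T - A) = card X + card (T - X - A)"
        using assms(1) fin by (metis card_Un_disjoint finite_Diff)
      then show "bernoulli_weight T p A = (1 - p) ^ card X * bernoulli_weight (T - X) p A"
        by (simp add: bernoulli_weight_def power_add)
    qed
    also have "\<dots> = (1 - p) ^ card X"
      using assms by (simp add: sum_distrib_left[symmetric] sum_bernoulli_weight)
    finally show ?thesis .
  qed
  have "cov T (bernoulli_weight T p) X = (\<Sum>A\<in>Pow T. bernoulli_weight T p A
      - bernoulli_weight T p A * of_bool (A \<inter> X = {}))"
    unfolding cov_def by (intro sum.cong refl) auto
  then show ?thesis using assms by (simp add: sum_subtractf sum_bernoulli_weight miss)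
qed

text \<open>
  The universe of all subsets of \<open>T\<close> is exponential, but only the values on \<open>T\<close> and on its subsets of
  size at most \<open>l\<close> matter, so polynomially many children suffice.
\<close>

lemma ex_sparse_cov:
  assumes "finite T" "\<And>A. A \<subseteq> T \<Longrightarrow> 0 \<le> w A"
  obtains w' where "\<And>A. A \<subseteq> T \<Longrightarrow> 0 \<le> w' A"
    "card {A. A \<subseteq> T \<and> w' A \<noteq> 0} \<le> (card T + 1) ^ l + 1"
    "\<And>X. X \<subseteq> T \<Longrightarrow> card X \<le> l \<Longrightarrow> cov T w' X = cov T w X"
    "cov T w' T = cov T w T"
proof -
  define I where "I = insert T {X. X \<subseteq> T \<and> card X \<le> l}"
  have "finite I" using assms by (auto simp: I_def)
  have "card I \<le> (card T + 1) ^ l + 1"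
    unfolding I_def by (intro order.trans[OF card_insert_le_m1] add_mono card_bounded_subsets_le assms)
      (use card_bounded_subsets_le[OF assms(1), of l] in auto)
  \<comment> \<open>The vectors are the children \<open>A\<close>, the coordinates are the test sets
    in \<open>I\<close>.\<close>
  moreover obtain w' where w': "\<forall>A\<in>Pow T. 0 \<le> w' A" "card {A\<in>Pow T. w' A \<noteq> 0} \<le> card I"
     "\<forall>X\<in>I. cov T w' X = cov T w X"
    unfolding cov_def
    using conic_caratheodory[OF \<open>finite I\<close>, of "Pow T" w "\<lambda>A X. of_bool (A \<inter> X \<noteq> {})"] assms
    by auto
  ultimately show ?thesis by (intro that[of w']) (auto simp: I_def)
qed

text \<open>The coefficients \<open>c\<close> express the cardinality of small sets through coverage
  by random subsets. The positive ones make up the bad function, the negative ones are added to the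
  singletons to make up the good function. Both mixtures are bounded by \<open>C\<close>, which
  depends on \<open>l\<close> but not on \<open>k\<close>; sparsification then keeps the number of
  children polynomial in \<open>k\<close>.\<close>

lemma ex_good_bad_weights:
  assumes "l > 0"
  shows "\<exists>C\<ge>0. \<forall>k. \<exists>g b :: nat set \<Rightarrow> real.
     (\<forall>A. A \<subseteq> {..<k} \<longrightarrow> 0 \<le> g A \<and> 0 \<le> b A) \<and>
     (\<forall>X. X \<subseteq> {..<k} \<longrightarrow> card X \<le> l \<longrightarrow> cov {..<k} g X = cov {..<k} b X) \<and>
     cov {..<k} b {..<k} \<le> C \<and>
     (\<forall>X. X \<subseteq> {..<k} \<longrightarrow> cov {..<k} g X \<le> real (card X) + C) \<and>
     real k \<le> cov {..<k} g {..<k} \<and>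
     card {A. A \<subseteq> {..<k} \<and> (g A \<noteq> 0 \<or> b A \<noteq> 0)} \<le> 2 * ((k + 1) ^ l + 1) + k"
proof -
  \<comment> \<open>The density step \<open>1 / l\<close> keeps every density \<open>j / l\<close>
    with \<open>j \<le> l\<close> at most 1, so that the Bernoulli weights are nonnegative.\<close>
  define c :: "nat \<Rightarrow> real" where "c j = (-1) ^ Suc j * real (l choose j) / (real j * (1 / real l))" for j
  define C where "C = (\<Sum>j=1..l. \<bar>c j\<bar>)"
  have "C \<ge> 0" unfolding C_def by (intro sum_nonneg) auto
  moreover have "\<exists>g b :: nat set \<Rightarrow> real.
     (\<forall>A. A \<subseteq> {..<k} \<longrightarrow> 0 \<le> g A \<and> 0 \<le> b A) \<and>
     (\<forall>X. X \<subseteq> {..<k} \<longrightarrow> card X \<le> l \<longrightarrow> cov {..<k} g X = cov {..<k} b X) \<and>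
     cov {..<k} b {..<k} \<le> C \<and>
     (\<forall>X. X \<subseteq> {..<k} \<longrightarrow> cov {..<k} g X \<le> real (card X) + C) \<and>
     real k \<le> cov {..<k} g {..<k} \<and>
     card {A. A \<subseteq> {..<k} \<and> (g A \<noteq> 0 \<or> b A \<noteq> 0)} \<le> 2 * ((k + 1) ^ l + 1) + k" for k
  proof -
    define T where "T = {..<k}"
    have T: "finite T" "card T = k" by (auto simp: T_def)
    define W where "W j = bernoulli_weight T (real j * (1 / real l))" for j
    define mix where "mix d A = (\<Sum>j=1..l. d j * W j A)" for d A
    have cov_mix: "cov T (mix d) X = (\<Sum>j=1..l. d j * (1 - (1 - real j * (1 / real l)) ^ card X))"
      if "X \<subseteq> T" for d X
      unfolding mix_def cov_sum W_def using T that by (simp add: cov_bernoulli_weight)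
    have le1: "0 \<le> real j * (1 / real l)" "real j * (1 / real l) \<le> 1" if "j \<in> {1..l}" for j
      using that by (auto simp: field_simps)
    have W: "0 \<le> W j A" if "j \<in> {1..l}" for j A
      unfolding W_def bernoulli_weight_def using le1[OF that] by simp
    have mix_nonneg: "0 \<le> mix d A" if "\<And>j. 0 \<le> d j" for d A
      unfolding mix_def using W that by (intro sum_nonneg mult_nonneg_nonneg) auto
    have mix_le: "cov T (mix d) X \<le> C" if "X \<subseteq> T" "\<And>j. d j \<le> \<bar>c j\<bar>" "\<And>j. 0 \<le> d j" for d X
      unfolding cov_mix[OF that(1)] C_def
    proof (rule sum_mono)
      fix j assume j: "j \<in> {1..l}"
      have "d j * (1 - (1 - real j * (1 / real l)) ^ card X) \<le> d j * 1"
        using le1[OF j] that(3) by (intro mult_left_mono) auto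
      with that(2)[of j] show "d j * (1 - (1 - real j * (1 / real l)) ^ card X) \<le> \<bar>c j\<bar>" by simp
    qed
    obtain b where b: "\<And>A. A \<subseteq> T \<Longrightarrow> 0 \<le> b A" "card {A. A \<subseteq> T \<and> b A \<noteq> 0} \<le> (card T + 1) ^ l + 1"
      "\<And>X. X \<subseteq> T \<Longrightarrow> card X \<le> l \<Longrightarrow> cov T b X = cov T (mix (\<lambda>j. max 0 (c j))) X"
      "cov T b T = cov T (mix (\<lambda>j. max 0 (c j))) T"
      by (rule ex_sparse_cov[OF T(1), of "mix (\<lambda>j. max 0 (c j))" l])
        (use mix_nonneg[of "\<lambda>j. max 0 (c j)"] in auto)
    obtain e where e: "\<And>A. A \<subseteq> T \<Longrightarrow> 0 \<le> e A" "card {A. A \<subseteq> T \<and> e A \<noteq> 0} \<le> (card T + 1) ^ l + 1"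
      "\<And>X. X \<subseteq> T \<Longrightarrow> card X \<le> l \<Longrightarrow> cov T e X = cov T (mix (\<lambda>j. max 0 (- c j))) X"
      "cov T e T = cov T (mix (\<lambda>j. max 0 (- c j))) T"
      by (rule ex_sparse_cov[OF T(1), of "mix (\<lambda>j. max 0 (- c j))" l])
        (use mix_nonneg[of "\<lambda>j. max 0 (- c j)"] in auto)
    \<comment> \<open>The singletons supply the linear summand of \<open>g\<close>: their coverage
      of \<open>X\<close> is \<open>card X\<close>.\<close>
    define s :: "nat set \<Rightarrow> real" where "s A = of_bool (card A = 1)" for A
    have singles: "{A. A \<subseteq> T \<and> s A \<noteq> 0} = (\<lambda>x. {x}) ` T"
      by (auto simp: s_def card_1_singleton_iff)
    have cov_s: "cov T s X = real (card X)" if "X \<subseteq> T" for X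
    proof -
      have "cov T s X = (\<Sum>A\<in>(\<lambda>x. {x}) ` X. 1)"
        unfolding cov_def using T that
        by (intro sum.mono_neutral_cong_right) (auto simp: s_def card_1_singleton_iff)
      then show ?thesis by (simp add: card_image)
    qed
    define g where "g A = s A + e A" for A
    have cov_g: "cov T g X = cov T s X + cov T e X" for X
      unfolding g_def by (rule cov_add)
    have nonneg: "0 \<le> g A" "0 \<le> b A" if "A \<subseteq> T" for A
      using e(1) b(1) that by (auto simp: g_def s_def)
    have "cov T g X = cov T b X" if "X \<subseteq> T" "card X \<le> l" for X
    proof -
      have "cov T b X - cov T e X = (\<Sum>j=1..l. c j * (1 - (1 - real j * (1 / real l)) ^ card X))"
        unfolding b(3)[OF that] e(3)[OF that] cov_mix[OF that(1)] sum_subtractf[symmetric]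
        by (intro sum.cong refl) (auto simp: max_def algebra_simps)
      also have "\<dots> = real (card X)"
        unfolding c_def using that assms by (intro linear_as_geometric_combination) auto
      finally show ?thesis using cov_s[OF that(1)] cov_g by simp
    qed
    moreover have "cov T b T \<le> C"
      unfolding b(4) by (rule mix_le) auto
    moreover have "cov T g X \<le> real (card X) + C" if "X \<subseteq> T" for X
    proof -
      have "cov T e X \<le> cov T e T" using e(1) that by (intro cov_mono)
      also have "\<dots> \<le> C" unfolding e(4) by (rule mix_le) auto
      finally show ?thesis using cov_s[OF that] cov_g by simp
    qed
    moreover have "real k \<le> cov T g T"
      using cov_s[of T] cov_nonneg[of T e T] e(1) T by (simp add: cov_g)
    moreover have "card {A. A \<subseteq> T \<and> (g A \<noteq> 0 \<or> b A \<noteq> 0)} \<le> 2 * ((k + 1) ^ l + 1) + k"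
    proof -
      have "{A. A \<subseteq> T \<and> (g A \<noteq> 0 \<or> b A \<noteq> 0)} \<subseteq>
        (\<lambda>x. {x}) ` T \<union> {A. A \<subseteq> T \<and> e A \<noteq> 0} \<union> {A. A \<subseteq> T \<and> b A \<noteq> 0}"
        unfolding singles[symmetric] by (auto simp: g_def)
      then have "card {A. A \<subseteq> T \<and> (g A \<noteq> 0 \<or> b A \<noteq> 0)} \<le>
        card ((\<lambda>x. {x}) ` T \<union> {A. A \<subseteq> T \<and> e A \<noteq> 0} \<union> {A. A \<subseteq> T \<and> b A \<noteq> 0})"
        using T by (intro card_mono) auto
      also have "\<dots> \<le> card ((\<lambda>x. {x}) ` T) + card {A. A \<subseteq> T \<and> e A \<noteq> 0} + card {A. A \<subseteq> T \<and> b A \<noteq> 0}"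
        by (intro order.trans[OF card_Un_le] add_right_mono card_Un_le)
      also have "\<dots> \<le> 2 * ((k + 1) ^ l + 1) + k"
        using e(2) b(2) T card_image_le[OF T(1), of "\<lambda>x. {x}"] by simp
      finally show ?thesis .
    qed
    ultimately show ?thesis using nonneg unfolding T_def by (intro exI[of _ g] exI[of _ b]) simp
  qed
  ultimately show ?thesis by blast
qed

section \<open>Indistinguishable families\<close>

text \<open>A finite universe of any type is transported along an injection to the natural numbers,
  where the definition expects it.\<close>

lemma coverage_withI:
  fixes U :: "'a set" and T :: "nat \<Rightarrow> 'a set"
  assumes "finite U" "P (card U)" "\<And>a. a \<in> U \<Longrightarrow> 0 \<le> w a"
    "\<And>e. e \<in> ground n \<Longrightarrow> T e \<subseteq> U"
    "\<And>S. S \<subseteq> ground n \<Longrightarrow> f S = (\<Sum>a\<in>(\<Union>e\<in>S. T e). w a)"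
  shows "coverage_with n P f"
proof -
  obtain h :: "'a \<Rightarrow> nat" where h: "inj_on h U"
    using finite_imp_inj_to_nat_seg[OF assms(1)] by blast
  define w' where "w' = w \<circ> the_inv_into U h"
  have w': "w' (h a) = w a" if "a \<in> U" for a
    using h that by (simp add: w'_def the_inv_into_f_f)
  have "f S = (\<Sum>a\<in>(\<Union>e\<in>S. h ` T e). w' a)" if S: "S \<subseteq> ground n" for S
  proof -
    have sub: "(\<Union>e\<in>S. T e) \<subseteq> U" using assms(4) S by blast
    have "(\<Sum>a\<in>(\<Union>e\<in>S. h ` T e). w' a) = (\<Sum>a\<in>h ` (\<Union>e\<in>S. T e). w' a)"
      by (simp add: image_UN)
    also have "\<dots> = (\<Sum>a\<in>(\<Union>e\<in>S. T e). w a)"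
      using inj_on_subset[OF h sub] sub w' by (subst sum.reindex) (auto intro!: sum.cong)
    finally show ?thesis using assms(5)[OF S] by simp
  qed
  then show ?thesis
    unfolding coverage_with_def using assms(1-3) w' h
    by (intro exI[of _ "h ` U"] exI[of _ w'] exI[of _ "\<lambda>e. h ` T e"] conjI)
      (simp_all add: card_image image_mono assms(4))
qed

lemma finite_card_constraint: "finite (card_constraint n k)"
  by (rule finite_subset[of _ "Pow (ground n)"]) (auto simp: card_constraint_def ground_def)

text \<open>
  Averaging argument: for a fixed list of samples that does not separate the functions \<open>f \<theta> i\<close>, the
  algorithm returns the same distribution for every \<open>i\<close>, so few of the \<open>i\<close> can be served well.
\<close>

lemma not_optimizable_from_samplesI:
  fixes f :: "'p \<Rightarrow> nat \<Rightarrow> nat set \<Rightarrow> real"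
  assumes "finite \<Theta>" "\<Theta> \<noteq> {}" "r > 0"
    and F: "\<And>\<theta> i. \<theta> \<in> \<Theta> \<Longrightarrow> i < r \<Longrightarrow> f \<theta> i \<in> F"
    and nonneg: "\<And>\<theta> i S. \<theta> \<in> \<Theta> \<Longrightarrow> i < r \<Longrightarrow> S \<in> card_constraint n k \<Longrightarrow> 0 \<le> f \<theta> i S"
    and opt: "real (card {\<theta>\<in>\<Theta>. \<exists>i<r. Max (f \<theta> i ` card_constraint n k) < V}) \<le> \<eta>1 * real (card \<Theta>)"
    and indist: "\<And>S. S \<subseteq> ground n \<Longrightarrow>
      real (card {\<theta>\<in>\<Theta>. \<exists>i<r. \<exists>j<r. f \<theta> i S \<noteq> f \<theta> j S}) \<le> \<eta>2 * real (card \<Theta>)"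
    and avg: "\<And>\<theta> S. \<theta> \<in> \<Theta> \<Longrightarrow> S \<in> card_constraint n k \<Longrightarrow> (\<Sum>i<r. f \<theta> i S) \<le> real r * W"
    and D: "set_pmf D \<subseteq> Pow (ground n)"
    and pos: "0 < \<alpha>" "0 < V"
    and small: "W / (\<alpha> * V) + \<eta>1 + real m * \<eta>2 < 1 - \<delta>"
  shows "\<not> optimizable_from_samples n F D k \<alpha> m \<delta>"
proof
  assume "optimizable_from_samples n F D k \<alpha> m \<delta>"
  then obtain A :: "(nat set \<times> real) list \<Rightarrow> nat set pmf" where
    "(\<forall>xs. set_pmf (A xs) \<subseteq> card_constraint n k) \<and>
     (\<forall>g\<in>F. measure_pmf.prob (replicate_pmf m D)
       {Ss. measure_pmf.expectation (A (map (\<lambda>S. (S, g S)) Ss)) g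
          \<ge> \<alpha> * Max (g ` card_constraint n k)} \<ge> 1 - \<delta>)"
    unfolding optimizable_from_samples_def by (rule exE)
  then have A: "\<And>xs. set_pmf (A xs) \<subseteq> card_constraint n k" and
    succ: "\<And>g. g \<in> F \<Longrightarrow> measure_pmf.prob (replicate_pmf m D)
       {Ss. measure_pmf.expectation (A (map (\<lambda>S. (S, g S)) Ss)) g
          \<ge> \<alpha> * Max (g ` card_constraint n k)} \<ge> 1 - \<delta>"
    by simp_all
  define E where "E \<theta> i = {Ss. measure_pmf.expectation (A (map (\<lambda>S. (S, f \<theta> i S)) Ss)) (f \<theta> i)
          \<ge> \<alpha> * Max (f \<theta> i ` card_constraint n k)}" for \<theta> i
  define Bad where "Bad = {\<theta>\<in>\<Theta>. \<exists>i<r. Max (f \<theta> i ` card_constraint n k) < V}"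
  define Dist where "Dist S = {\<theta>\<in>\<Theta>. \<exists>i<r. \<exists>j<r. f \<theta> i S \<noteq> f \<theta> j S}" for S
  define N where "N Ss = (\<Sum>\<theta>\<in>\<Theta>. \<Sum>i<r. indicator (E \<theta> i) Ss :: real)" for Ss
  have [simp]: "integrable (measure_pmf (A xs)) g" for xs and g :: "nat set \<Rightarrow> real"
    using finite_subset[OF A finite_card_constraint] by (rule integrable_measure_pmf_finite)

  \<comment> \<open>The same distribution of answers serves every \<open>i\<close>. Each success
    requires expected value at least \<open>\<alpha> * V\<close>, while the expected values for all
    \<open>i\<close> together are at most \<open>r * W\<close>.\<close>
  have count: "(\<Sum>i<r. indicator (E \<theta> i) Ss :: real) \<le> real r * (W / (\<alpha> * V))"
    if \<theta>: "\<theta> \<in> \<Theta>" "\<theta> \<notin> Bad" "\<And>S. S \<in> set Ss \<Longrightarrow> \<theta> \<notin> Dist S" for \<theta> Ss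
  proof -
    define xs where "xs = map (\<lambda>S. (S, f \<theta> 0 S)) Ss"
    have xs: "map (\<lambda>S. (S, f \<theta> i S)) Ss = xs" if "i < r" for i
      unfolding xs_def
    proof (rule map_cong[OF refl])
      fix S assume "S \<in> set Ss"
      then have "f \<theta> i S = f \<theta> 0 S"
        using \<theta>(1) \<theta>(3)[of S] that \<open>r > 0\<close> unfolding Dist_def by blast
      then show "(S, f \<theta> i S) = (S, f \<theta> 0 S)" by simp
    qed
    have each: "\<alpha> * V * indicator (E \<theta> i) Ss \<le> measure_pmf.expectation (A xs) (f \<theta> i)" if i: "i < r" for i
    proof (cases "Ss \<in> E \<theta> i")
      case True
      have "\<not> Max (f \<theta> i ` card_constraint n k) < V"
        using \<theta>(1,2) i unfolding Bad_def by blast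
      then have "\<alpha> * V \<le> \<alpha> * Max (f \<theta> i ` card_constraint n k)" using pos by simp
      with True xs[OF i] show ?thesis by (simp add: E_def)
    next
      case False
      have "0 \<le> measure_pmf.expectation (A xs) (f \<theta> i)"
        using A nonneg[OF \<theta>(1) i] by (intro integral_nonneg_AE) (auto simp: AE_measure_pmf_iff)
      with False show ?thesis by simp
    qed
    have "(\<Sum>i<r. \<alpha> * V * indicator (E \<theta> i) Ss) \<le> (\<Sum>i<r. measure_pmf.expectation (A xs) (f \<theta> i))"
      using each by (intro sum_mono) auto
    also have "\<dots> = measure_pmf.expectation (A xs) (\<lambda>S. \<Sum>i<r. f \<theta> i S)"
      by (subst Bochner_Integration.integral_sum) auto
    also have "\<dots> \<le> real r * W"
      using A avg[OF \<theta>(1)] by (intro measure_pmf.integral_le_const) (auto simp: AE_measure_pmf_iff)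
    finally show ?thesis using pos by (simp add: sum_distrib_left[symmetric] field_simps)
  qed

  \<comment> \<open>\<open>N\<close> counts the pairs \<open>(\<theta>, i)\<close> that are served
    well on \<open>Ss\<close>. Parameters in \<open>Bad\<close>, or separated by one of the
    \<open>m\<close> samples, are given up and charged the maximum \<open>r\<close>.\<close>
  have N_le: "N Ss \<le> real (card \<Theta>) * real r * (W / (\<alpha> * V) + \<eta>1 + real m * \<eta>2)"
    if Ss: "length Ss = m" "\<And>S. S \<in> set Ss \<Longrightarrow> S \<subseteq> ground n" for Ss
  proof -
    \<comment> \<open>The empty set is feasible. Nonnegativity lets the bound with \<open>W\<close>
      be kept for the parameters that are given up as well.\<close>
    have W0: "0 \<le> W"
    proof -
      obtain \<theta> where \<theta>: "\<theta> \<in> \<Theta>" using assms(2) by blast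
      have e: "{} \<in> card_constraint n k" by (simp add: card_constraint_def)
      have "0 \<le> (\<Sum>i<r. f \<theta> i {})" using nonneg[OF \<theta> _ e] by (intro sum_nonneg) auto
      also have "\<dots> \<le> real r * W" by (rule avg[OF \<theta> e])
      finally show ?thesis using \<open>r > 0\<close> by (simp add: zero_le_mult_iff)
    qed
    define B where "B = Bad \<union> (\<Union>S\<in>set Ss. Dist S)"
    have "B \<subseteq> \<Theta>" by (auto simp: B_def Bad_def Dist_def)
    have "real (card (\<Union>S\<in>set Ss. Dist S)) \<le> real (\<Sum>S\<in>set Ss. card (Dist S))"
      by (intro of_nat_mono card_UN_le) auto
    also have "\<dots> \<le> (\<Sum>S\<in>set Ss. \<eta>2 * real (card \<Theta>))"
      unfolding of_nat_sum Dist_def using indist Ss(2) by (intro sum_mono) blast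
    also have "\<dots> = real (card (set Ss)) * (\<eta>2 * real (card \<Theta>))" by simp
    also have "\<dots> \<le> real m * (\<eta>2 * real (card \<Theta>))"
      \<comment> \<open>The query of the empty set shows that \<open>\<eta>2 * card \<Theta>\<close>
        is nonnegative.\<close>
      using Ss(1) card_length[of Ss] order.trans[OF _ indist[of "{}"]]
      by (intro mult_right_mono) auto
    finally have "real (card B) \<le> \<eta>1 * real (card \<Theta>) + real m * (\<eta>2 * real (card \<Theta>))"
      using opt card_Un_le[of Bad "\<Union>S\<in>set Ss. Dist S"] by (simp add: B_def Bad_def)
    then have B: "real (card B) \<le> real (card \<Theta>) * (\<eta>1 + real m * \<eta>2)" by (simp add: algebra_simps)
    have "N Ss \<le> (\<Sum>\<theta>\<in>\<Theta>. real r * (W / (\<alpha> * V)) + real r * indicator B \<theta>)"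
      unfolding N_def
    proof (rule sum_mono)
      fix \<theta> assume "\<theta> \<in> \<Theta>"
      show "(\<Sum>i<r. indicator (E \<theta> i) Ss) \<le> real r * (W / (\<alpha> * V)) + real r * indicator B \<theta>"
      proof (cases "\<theta> \<in> B")
        case True
        have "(\<Sum>i<r. indicator (E \<theta> i) Ss :: real) \<le> (\<Sum>i<r. 1)"
          by (intro sum_mono) (auto simp: indicator_def)
        moreover have "0 \<le> real r * (W / (\<alpha> * V))" using W0 pos by simp
        ultimately show ?thesis using True by simp
      next
        case False
        with count[OF \<open>\<theta> \<in> \<Theta>\<close>] show ?thesis by (auto simp: B_def)
      qed
    qed
    also have "\<dots> = real (card \<Theta>) * (real r * (W / (\<alpha> * V))) + real r * real (card B)"
      using \<open>finite \<Theta>\<close> \<open>B \<subseteq> \<Theta>\<close>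
      by (simp add: sum.distrib sum_distrib_left[symmetric] indicator_def sum.If_cases Int_absorb1)
    also have "\<dots> \<le> real (card \<Theta>) * (real r * (W / (\<alpha> * V))) + real r * (real (card \<Theta>) * (\<eta>1 + real m * \<eta>2))"
      using B by (intro add_left_mono mult_left_mono) auto
    finally show ?thesis by (simp add: algebra_simps)
  qed

  have int: "integrable (measure_pmf (replicate_pmf m D)) (indicator (E \<theta> i) :: _ \<Rightarrow> real)" for \<theta> i
    by (rule measure_pmf.integrable_const_bound[where B = 1]) auto
  \<comment> \<open>Double counting: each pair is served well with probability at least
    \<open>1 - \<delta>\<close>, so the expectation of \<open>N\<close> is large, whereas
    \<open>N_le\<close> bounds \<open>N\<close> on every possible list of samples.\<close>
  have "real (card \<Theta>) * real r * (1 - \<delta>) = (\<Sum>\<theta>\<in>\<Theta>. \<Sum>i<r. 1 - \<delta>)" by simp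
  also have "\<dots> \<le> (\<Sum>\<theta>\<in>\<Theta>. \<Sum>i<r. measure_pmf.prob (replicate_pmf m D) (E \<theta> i))"
    unfolding E_def by (intro sum_mono succ F) auto
  also have "\<dots> = measure_pmf.expectation (replicate_pmf m D) N"
    unfolding N_def by (simp add: Bochner_Integration.integral_sum int)
  also have "\<dots> \<le> real (card \<Theta>) * real r * (W / (\<alpha> * V) + \<eta>1 + real m * \<eta>2)"
  proof (rule measure_pmf.integral_le_const)
    show "integrable (measure_pmf (replicate_pmf m D)) N"
      unfolding N_def by (intro Bochner_Integration.integrable_sum int)
    show "AE Ss in measure_pmf (replicate_pmf m D).
        N Ss \<le> real (card \<Theta>) * real r * (W / (\<alpha> * V) + \<eta>1 + real m * \<eta>2)"
      unfolding AE_measure_pmf_iff set_replicate_pmf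
    proof
      fix Ss assume "Ss \<in> {xs \<in> lists (set_pmf D). length xs = m}"
      with D show "N Ss \<le> real (card \<Theta>) * real r * (W / (\<alpha> * V) + \<eta>1 + real m * \<eta>2)"
        by (intro N_le) auto
    qed
  qed
  finally have "1 - \<delta> \<le> W / (\<alpha> * V) + \<eta>1 + real m * \<eta>2"
    using assms(1-3) by (simp add: card_gt_0_iff)
  with small show False by simp
qed

section \<open>Counting maps by their behaviour on a subset of the domain\<close>

lemma card_PiE_const_image_subset:
  assumes "finite G" "finite \<Omega>" "S \<subseteq> G" "B \<subseteq> \<Omega>" "\<Omega> \<noteq> {}"
  shows "real (card {\<theta>\<in>PiE G (\<lambda>_. \<Omega>). \<theta> ` S \<subseteq> B}) =
    (real (card B) / real (card \<Omega>)) ^ card S * real (card (PiE G (\<lambda>_. \<Omega>)))"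
proof -
  have fin: "finite S" using assms finite_subset by blast
  have "{\<theta>\<in>PiE G (\<lambda>_. \<Omega>). \<theta> ` S \<subseteq> B} = PiE G (\<lambda>e. if e \<in> S then B else \<Omega>)"
  proof (intro set_eqI iffI)
    fix \<theta> assume "\<theta> \<in> {\<theta>\<in>PiE G (\<lambda>_. \<Omega>). \<theta> ` S \<subseteq> B}"
    then show "\<theta> \<in> PiE G (\<lambda>e. if e \<in> S then B else \<Omega>)" by (auto simp: PiE_iff)
  next
    fix \<theta> assume \<theta>: "\<theta> \<in> PiE G (\<lambda>e. if e \<in> S then B else \<Omega>)"
    then have mem: "\<theta> e \<in> (if e \<in> S then B else \<Omega>)" if "e \<in> G" for e using that by (rule PiE_mem)
    have "\<theta> e \<in> \<Omega>" if "e \<in> G" for e using mem[OF that] assms(4) by (auto split: if_splits)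
    moreover have "\<theta> e \<in> B" if "e \<in> S" for e using mem[of e] that assms(3) by auto
    ultimately show "\<theta> \<in> {\<theta>\<in>PiE G (\<lambda>_. \<Omega>). \<theta> ` S \<subseteq> B}"
      using \<theta> unfolding PiE_iff by blast
  qed
  then have "card {\<theta>\<in>PiE G (\<lambda>_. \<Omega>). \<theta> ` S \<subseteq> B} = (\<Prod>e\<in>G. card (if e \<in> S then B else \<Omega>))"
    using assms(1) by (simp add: card_PiE)
  also have "\<dots> = card B ^ card S * card \<Omega> ^ card (G - S)"
    using prod.subset_diff[OF assms(3,1), of "\<lambda>e. card (if e \<in> S then B else \<Omega>)"]
    by (simp add: mult.commute)
  finally have "real (card {\<theta>\<in>PiE G (\<lambda>_. \<Omega>). \<theta> ` S \<subseteq> B}) =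
      real (card B) ^ card S * real (card \<Omega>) ^ card (G - S)" by simp
  moreover have "card G = card S + card (G - S)"
    using assms(1,3) fin by (simp add: card_Diff_subset card_mono)
  then have "real (card (PiE G (\<lambda>_. \<Omega>))) = real (card \<Omega>) ^ card S * real (card \<Omega>) ^ card (G - S)"
    using assms(1) by (simp add: card_PiE power_add)
  ultimately show ?thesis
    using assms(2,5) by (simp add: power_divide field_simps)
qed

lemma card_PiE_const_avoid:
  assumes "finite G" "finite \<Omega>" "S \<subseteq> G" "B \<subseteq> \<Omega>" "\<Omega> \<noteq> {}"
  shows "real (card {\<theta>\<in>PiE G (\<lambda>_. \<Omega>). \<theta> ` S \<inter> B = {}}) =
    (1 - real (card B) / real (card \<Omega>)) ^ card S * real (card (PiE G (\<lambda>_. \<Omega>)))"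
proof -
  have "{\<theta>\<in>PiE G (\<lambda>_. \<Omega>). \<theta> ` S \<inter> B = {}} = {\<theta>\<in>PiE G (\<lambda>_. \<Omega>). \<theta> ` S \<subseteq> \<Omega> - B}"
    using assms(3) by (auto simp: PiE_iff)
  moreover have "real (card (\<Omega> - B)) / real (card \<Omega>) = 1 - real (card B) / real (card \<Omega>)"
    using assms(2,4,5) finite_subset[OF assms(4,2)]
    by (simp add: card_Diff_subset of_nat_diff card_mono diff_divide_distrib)
  ultimately show ?thesis
    using card_PiE_const_image_subset[OF assms(1-3), of "\<Omega> - B"] assms(5) by simp
qed

text \<open>Union bound: \<open>q\<close> distinct values in \<open>B\<close> have \<open>q\<close>
  distinct preimages in \<open>S\<close>, and \<open>S\<close> has at most \<open>card S ^ q\<close>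
  subsets of size \<open>q\<close>.\<close>

lemma card_PiE_const_many_hits:
  assumes "finite G" "finite \<Omega>" "S \<subseteq> G" "B \<subseteq> \<Omega>" "\<Omega> \<noteq> {}"
  shows "real (card {\<theta>\<in>PiE G (\<lambda>_. \<Omega>). q \<le> card (\<theta> ` S \<inter> B)}) \<le>
    (real (card S) * real (card B) / real (card \<Omega>)) ^ q * real (card (PiE G (\<lambda>_. \<Omega>)))"
proof -
  define \<Theta> where "\<Theta> = PiE G (\<lambda>_. \<Omega>)"
  have fin: "finite S" "finite \<Theta>"
    using assms finite_subset by (auto simp: \<Theta>_def intro!: finite_PiE)
  define \<Q> where "\<Q> = {Q. Q \<subseteq> S \<and> card Q = q}"
  have \<Q>: "finite \<Q>" "card \<Q> = card S choose q"
    using fin by (auto simp: \<Q>_def n_subsets)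
  have "{\<theta>\<in>\<Theta>. q \<le> card (\<theta> ` S \<inter> B)} \<subseteq> (\<Union>Q\<in>\<Q>. {\<theta>\<in>\<Theta>. \<theta> ` Q \<subseteq> B})"
  proof
    fix \<theta> assume "\<theta> \<in> {\<theta>\<in>\<Theta>. q \<le> card (\<theta> ` S \<inter> B)}"
    then have \<theta>: "\<theta> \<in> \<Theta>" "q \<le> card (\<theta> ` S \<inter> B)" by auto
    obtain Y where Y: "Y \<subseteq> \<theta> ` S \<inter> B" "card Y = q"
      using obtain_subset_with_card_n[OF \<theta>(2)] by blast
    then obtain Q where Q: "Q \<subseteq> S" "inj_on \<theta> Q" "Y = \<theta> ` Q"
      using subset_image_inj[of Y \<theta> S] by auto
    then have "Q \<in> \<Q>" using Y by (auto simp: \<Q>_def card_image)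
    with Q Y \<theta>(1) show "\<theta> \<in> (\<Union>Q\<in>\<Q>. {\<theta>\<in>\<Theta>. \<theta> ` Q \<subseteq> B})" by blast
  qed
  then have "card {\<theta>\<in>\<Theta>. q \<le> card (\<theta> ` S \<inter> B)} \<le> (\<Sum>Q\<in>\<Q>. card {\<theta>\<in>\<Theta>. \<theta> ` Q \<subseteq> B})"
    using fin \<Q> by (intro order.trans[OF card_mono card_UN_le]) auto
  then have "real (card {\<theta>\<in>\<Theta>. q \<le> card (\<theta> ` S \<inter> B)}) \<le> (\<Sum>Q\<in>\<Q>. real (card {\<theta>\<in>\<Theta>. \<theta> ` Q \<subseteq> B}))"
    unfolding of_nat_sum[symmetric] of_nat_le_iff .
  also have "\<dots> = (\<Sum>Q\<in>\<Q>. (real (card B) / real (card \<Omega>)) ^ q * real (card \<Theta>))"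
  proof (rule sum.cong[OF refl])
    fix Q assume "Q \<in> \<Q>"
    then have "Q \<subseteq> G" "card Q = q" using assms(3) by (auto simp: \<Q>_def)
    then show "real (card {\<theta>\<in>\<Theta>. \<theta> ` Q \<subseteq> B}) = (real (card B) / real (card \<Omega>)) ^ q * real (card \<Theta>)"
      using card_PiE_const_image_subset[OF assms(1,2) _ assms(4,5), of Q] by (simp add: \<Theta>_def)
  qed
  also have "\<dots> = real (card S choose q) * ((real (card B) / real (card \<Omega>)) ^ q * real (card \<Theta>))"
    by (simp add: \<Q>)
  also have "\<dots> \<le> real (card S) ^ q * ((real (card B) / real (card \<Omega>)) ^ q * real (card \<Theta>))"
  proof (intro mult_right_mono)
    show "real (card S choose q) \<le> real (card S) ^ q"
      unfolding of_nat_power[symmetric] of_nat_le_iff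
      by (cases "q \<le> card S") (simp_all add: binomial_le_pow binomial_eq_0)
  qed auto
  finally show ?thesis by (simp add: \<Theta>_def power_divide power_mult_distrib)
qed

section \<open>Masked parts\<close>

text \<open>
  Slot \<open>Inl (j, x)\<close> is element \<open>x\<close> of part \<open>j\<close>, slot \<open>Inr (a, c)\<close> is the \<open>c\<close>-th element of masking block \<open>a\<close>.
  Ground elements are mapped to slots by independent uniform choices, so \<open>u * b\<close> has to be well below
  \<open>n\<close> for this map to be onto, while a large \<open>b\<close> makes the parts rare among the slots.
\<close>

locale masked_parts =
  fixes r k u b l :: nat and g w :: "nat set \<Rightarrow> real" and C :: real
  assumes pos: "0 < r" "0 < k" "0 < u" "0 < b"
    and g_nonneg: "A \<subseteq> {..<k} \<Longrightarrow> 0 \<le> g A"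
    and w_nonneg: "A \<subseteq> {..<k} \<Longrightarrow> 0 \<le> w A"
    and agree: "Y \<subseteq> {..<k} \<Longrightarrow> card Y \<le> l \<Longrightarrow> cov {..<k} g Y = cov {..<k} w Y"
    and w_le: "cov {..<k} w {..<k} \<le> C"
    and g_le: "Y \<subseteq> {..<k} \<Longrightarrow> cov {..<k} g Y \<le> real (card Y) + C"
    and g_ge: "real k \<le> cov {..<k} g {..<k}"
begin

definition parts :: "nat set \<Rightarrow> (nat \<times> nat + nat \<times> nat) set" where
  "parts J = Inl ` (J \<times> {..<k})"

definition block :: "nat \<Rightarrow> (nat \<times> nat + nat \<times> nat) set" where
  "block a = Inr ` ({a} \<times> {..<b})"

definition slots :: "(nat \<times> nat + nat \<times> nat) set" where
  "slots = ({..<r} \<times> {..<k}) <+> ({..<u} \<times> {..<b})"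

definition trace :: "nat \<Rightarrow> (nat \<times> nat + nat \<times> nat) set \<Rightarrow> nat set" where
  "trace j X = {x. Inl (j, x) \<in> X}"

definition hit :: "(nat \<times> nat + nat \<times> nat) set \<Rightarrow> nat set" where
  "hit X = {a. \<exists>c. Inr (a, c) \<in> X}"

definition weight :: "nat \<Rightarrow> nat \<Rightarrow> nat set \<Rightarrow> real" where
  "weight i j = (if j = i then g else w)"

definition unmasked :: "nat \<Rightarrow> (nat \<times> nat + nat \<times> nat) set \<Rightarrow> real" where
  "unmasked i X = (\<Sum>j<r. cov {..<k} (weight i j) (trace j X))"

text \<open>The value of covering all parts. It is the same whichever part is good, so a set that
  meets every block reveals nothing.\<close>

definition total :: real where
  "total = cov {..<k} g {..<k} + real (r - 1) * cov {..<k} w {..<k}"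

text \<open>An average over \<open>u\<close> copies of the parts, one per block: a copy whose block
  is met is covered completely, any other copy only by the elements of the parts.\<close>

definition val :: "nat \<Rightarrow> (nat \<times> nat + nat \<times> nat) set \<Rightarrow> real" where
  "val i X = real (card (hit X)) / real u * total + (1 - real (card (hit X)) / real u) * unmasked i X"

text \<open>The empty set has to be left out: a block would cover it, whereas \<open>cov\<close>
  never counts it. Leaving out zero weights keeps the universe small.\<close>

definition supp :: "nat set set" where
  "supp = {A. A \<subseteq> {..<k} \<and> A \<noteq> {} \<and> (g A \<noteq> 0 \<or> w A \<noteq> 0)}"

definition children :: "(nat \<times> nat \<times> nat set) set" where
  "children = {..<u} \<times> {..<r} \<times> supp"

text \<open>
  Child \<open>(a, j, A)\<close> is the copy, belonging to block \<open>a\<close>, of the child \<open>A\<close> of part \<open>j\<close>: it is covered by all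
  of block \<open>a\<close> and by the elements of \<open>A\<close> in part \<open>j\<close>.
\<close>

definition child_weight :: "nat \<Rightarrow> nat \<times> nat \<times> nat set \<Rightarrow> real" where
  "child_weight i = (\<lambda>(a, j, A). weight i j A / real u)"

definition covered :: "nat \<times> nat + nat \<times> nat \<Rightarrow> (nat \<times> nat \<times> nat set) set" where
  "covered s = (case s of
      Inl (j, x) \<Rightarrow> {..<u} \<times> {j} \<times> {A\<in>supp. x \<in> A}
    | Inr (a, c) \<Rightarrow> {a} \<times> {..<r} \<times> supp)"

lemma finite_slots: "finite slots"
  by (simp add: slots_def)

lemma slots_nonempty: "slots \<noteq> {}"
  using pos by (auto simp: slots_def)

lemma card_slots: "card slots = r * k + u * b"
  by (simp add: slots_def card_Plus)

lemma finite_supp: "finite supp"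
  by (rule finite_subset[of _ "Pow {..<k}"]) (auto simp: supp_def)

lemma finite_children: "finite children"
  by (simp add: children_def finite_supp)

lemma card_children: "card children = u * (r * card supp)"
  by (simp add: children_def card_cartesian_product)

lemma weight_nonneg: "A \<subseteq> {..<k} \<Longrightarrow> 0 \<le> weight i j A"
  by (simp add: weight_def g_nonneg w_nonneg)

lemma trace_subset: "X \<subseteq> slots \<Longrightarrow> trace j X \<subseteq> {..<k}"
  by (auto simp: trace_def slots_def)

lemma hit_subset: "X \<subseteq> slots \<Longrightarrow> hit X \<subseteq> {..<u}"
  by (auto simp: hit_def slots_def)

lemma finite_trace: "X \<subseteq> slots \<Longrightarrow> finite (trace j X)"
  by (rule finite_subset[OF trace_subset]) auto

lemma card_hit_le:
  assumes "X \<subseteq> slots"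
  shows "card (hit X) \<le> u" "card (hit X) \<le> card X"
proof -
  show "card (hit X) \<le> u" using card_mono[OF _ hit_subset[OF assms]] by simp
  have fin: "finite X" using assms finite_slots finite_subset by blast
  have "hit X \<subseteq> (\<lambda>s. fst (projr s)) ` X" by (force simp: hit_def)
  then show "card (hit X) \<le> card X" using fin by (rule surj_card_le[rotated])
qed

lemma sum_card_trace_le:
  assumes "X \<subseteq> slots"
  shows "(\<Sum>j<r. card (trace j X)) \<le> card X"
proof -
  have fin: "finite X" using assms finite_slots finite_subset by blast
  have "(\<Sum>j<r. card (trace j X)) = card (SIGMA j:{..<r}. trace j X)"
    using finite_trace[OF assms] by (simp add: card_SigmaI)
  also have "\<dots> = card (Inl ` (SIGMA j:{..<r}. trace j X) :: (nat \<times> nat + nat \<times> nat) set)"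
    by (simp add: card_image)
  also have "\<dots> \<le> card X" by (intro card_mono fin) (auto simp: trace_def)
  finally show ?thesis .
qed

lemma sum_weight_split:
  assumes "i < r"
  shows "(\<Sum>j<r. cov {..<k} (weight i j) (Y j)) =
    cov {..<k} g (Y i) + (\<Sum>j\<in>{..<r} - {i}. cov {..<k} w (Y j))"
  using assms by (subst sum.remove[of _ i]) (auto simp: weight_def intro!: sum.cong)

lemma sum_weight_total: "i < r \<Longrightarrow> (\<Sum>j<r. cov {..<k} (weight i j) {..<k}) = total"
  by (simp add: sum_weight_split total_def)

lemma unmasked_nonneg: "0 \<le> unmasked i X"
  unfolding unmasked_def by (intro sum_nonneg cov_nonneg weight_nonneg)

lemma cov_w_le:
  assumes "Y \<subseteq> {..<k}"
  shows "cov {..<k} w Y \<le> C"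
  using cov_mono[of "{..<k}" w Y "{..<k}"] w_nonneg assms w_le by fastforce

lemma C_nonneg: "0 \<le> C"
  using cov_nonneg[of "{..<k}" w "{..<k}"] w_nonneg w_le by fastforce

lemma total_nonneg: "0 \<le> total"
  using g_ge cov_nonneg[of "{..<k}" w "{..<k}"] w_nonneg by (simp add: total_def)

lemma total_le: "total \<le> real k + real r * C"
proof -
  have "real (r - 1) * cov {..<k} w {..<k} \<le> real (r - 1) * C"
    by (intro mult_left_mono w_le) simp
  also have "\<dots> = real r * C - C" using pos by (simp add: of_nat_diff algebra_simps)
  finally show ?thesis using g_le[of "{..<k}"] by (simp add: total_def)
qed

lemma val_nonneg: "X \<subseteq> slots \<Longrightarrow> 0 \<le> val i X"
  unfolding val_def using card_hit_le(1)[of X] total_nonneg unmasked_nonneg pos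
  by (intro add_nonneg_nonneg mult_nonneg_nonneg) auto

section \<open>The masked functions as coverage functions, and their values\<close>

lemma UN_covered:
  assumes "X \<subseteq> slots"
  shows "(\<Union>s\<in>X. covered s) = {(a, j, A). a < u \<and> j < r \<and> A \<in> supp \<and> (a \<in> hit X \<or> A \<inter> trace j X \<noteq> {})}"
    (is "_ = ?R")
proof (intro set_eqI iffI)
  fix z assume "z \<in> (\<Union>s\<in>X. covered s)"
  then obtain s where s: "s \<in> X" "z \<in> covered s" by blast
  then have "s \<in> slots" using assms by blast
  with s show "z \<in> ?R"
    by (cases s) (auto simp: covered_def slots_def hit_def trace_def)
next
  fix z assume "z \<in> ?R"
  then obtain a j A where z: "z = (a, j, A)" "a < u" "j < r" "A \<in> supp"
    and "a \<in> hit X \<or> A \<inter> trace j X \<noteq> {}" by auto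
  then consider c where "Inr (a, c) \<in> X" | x where "x \<in> A" "Inl (j, x) \<in> X"
    by (auto simp: hit_def trace_def)
  then show "z \<in> (\<Union>s\<in>X. covered s)"
  proof cases
    case 1
    then show ?thesis using z by (intro UN_I[of "Inr (a, c)"]) (auto simp: covered_def)
  next
    case 2
    then show ?thesis using z by (intro UN_I[of "Inl (j, x)"]) (auto simp: covered_def)
  qed
qed

lemma cov_weight_supp:
  "cov {..<k} (weight i j) Y = (\<Sum>A\<in>supp. weight i j A * of_bool (A \<inter> Y \<noteq> {}))"
  unfolding cov_def
  by (rule sum.mono_neutral_right) (auto simp: supp_def weight_def)

text \<open>Grouping the children by block: in the copy of block \<open>a\<close>, part
  \<open>j\<close> is covered as if the trace were \<open>Y a j\<close>, which is the whole part if
  the block is met. Each copy thus contributes \<open>total\<close> or \<open>unmasked i X\<close>,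
  divided by \<open>u\<close>.\<close>

lemma val_eq_sum_children:
  assumes "X \<subseteq> slots" "i < r"
  shows "val i X = (\<Sum>z\<in>(\<Union>s\<in>X. covered s). child_weight i z)"
proof -
  define Y where "Y a j = (if a \<in> hit X then {..<k} else trace j X)" for a j
  have "(\<Sum>z\<in>(\<Union>s\<in>X. covered s). child_weight i z) =
      (\<Sum>z\<in>children. child_weight i z * of_bool (z \<in> (\<Union>s\<in>X. covered s)))"
    unfolding UN_covered[OF assms(1)] using finite_children
    by (intro sum.mono_neutral_cong_left) (auto simp: children_def)
  also have "\<dots> = (\<Sum>a<u. \<Sum>j<r. \<Sum>A\<in>supp. child_weight i (a, j, A) * of_bool (a \<in> hit X \<or> A \<inter> trace j X \<noteq> {}))"
    unfolding UN_covered[OF assms(1)] children_def sum.cartesian_product'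
    by (intro sum.cong refl) auto
  also have "\<dots> = (\<Sum>a<u. \<Sum>j<r. cov {..<k} (weight i j) (Y a j) / real u)"
  proof (intro sum.cong refl)
    fix a j
    have "A \<inter> {..<k} \<noteq> {}" if "A \<in> supp" for A using that by (auto simp: supp_def)
    then have "of_bool (a \<in> hit X \<or> A \<inter> trace j X \<noteq> {}) = (of_bool (A \<inter> Y a j \<noteq> {}) :: real)"
      if "A \<in> supp" for A using that by (auto simp: Y_def)
    then show "(\<Sum>A\<in>supp. child_weight i (a, j, A) * of_bool (a \<in> hit X \<or> A \<inter> trace j X \<noteq> {})) =
        cov {..<k} (weight i j) (Y a j) / real u"
      unfolding cov_weight_supp sum_divide_distrib child_weight_def
      by (intro sum.cong refl) simp
  qed
  also have "\<dots> = (\<Sum>a<u. if a \<in> hit X then total / real u else unmasked i X / real u)"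
    using sum_weight_total[OF assms(2)]
    by (intro sum.cong refl) (simp add: Y_def sum_divide_distrib[symmetric] unmasked_def)
  also have "\<dots> = real (card (hit X)) * (total / real u) + real (card ({..<u} - hit X)) * (unmasked i X / real u)"
    using hit_subset[OF assms(1)] by (simp add: sum.If_cases Int_absorb1 Diff_eq)
  also have "real (card ({..<u} - hit X)) = real u - real (card (hit X))"
    using hit_subset[OF assms(1)] card_hit_le(1)[OF assms(1)]
    by (simp add: card_Diff_subset finite_subset of_nat_diff)
  finally show ?thesis using pos by (simp add: val_def field_simps)
qed

text \<open>Each ground element covers the children of its slot, so elements that share a slot are
  interchangeable.\<close>

lemma coverage_with_val:
  assumes "i < r" "\<And>e. e \<in> ground n \<Longrightarrow> \<theta> e \<in> slots" "P (card children)"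
  shows "coverage_with n P (\<lambda>S. val i (\<theta> ` S))"
proof (rule coverage_withI[where U = children and w = "child_weight i" and T = "\<lambda>e. covered (\<theta> e)"])
  show "0 \<le> child_weight i z" if "z \<in> children" for z
    using that weight_nonneg by (auto simp: children_def child_weight_def supp_def)
  show "covered (\<theta> e) \<subseteq> children" if "e \<in> ground n" for e
    using assms(2)[OF that]
    by (cases "\<theta> e") (auto simp: covered_def children_def slots_def)
  show "val i (\<theta> ` S) = (\<Sum>z\<in>(\<Union>e\<in>S. covered (\<theta> e)). child_weight i z)" if "S \<subseteq> ground n" for S
    using val_eq_sum_children[of "\<theta> ` S" i] assms(1,2) that by (auto simp: image_subset_iff subset_iff)
qed (use assms(3) finite_children in auto)

lemma val_parts_ge:
  assumes "i < r"
  shows "real k \<le> val i (parts {i})"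
proof -
  have "trace j (parts {i}) = (if j = i then {..<k} else {})" for j
    by (auto simp: trace_def parts_def)
  then have "unmasked i (parts {i}) = cov {..<k} g {..<k} + (\<Sum>j\<in>{..<r} - {i}. cov {..<k} w {})"
    unfolding unmasked_def using assms by (simp add: sum_weight_split)
  then have "real k \<le> unmasked i (parts {i})"
    using g_ge by (simp add: cov_def)
  moreover have "hit (parts {i}) = {}" by (auto simp: hit_def parts_def)
  ultimately show ?thesis by (simp add: val_def)
qed

lemma val_eq_of_masked:
  assumes "hit X = {..<u}"
  shows "val i X = total"
  using assms pos by (simp add: val_def)

lemma unmasked_eq_of_small_traces:
  assumes "X \<subseteq> slots" "i < r" "\<And>j. j < r \<Longrightarrow> card (trace j X) \<le> l"
  shows "unmasked i X = (\<Sum>j<r. cov {..<k} w (trace j X))"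
  unfolding unmasked_def
  using agree[OF trace_subset[OF assms(1)] assms(3)] by (intro sum.cong refl) (auto simp: weight_def)

text \<open>A set of size at most \<open>k\<close> meets at most \<open>k\<close> of the
  \<open>u\<close> blocks, which yields the term with \<open>k / u\<close>. The bad parts yield at
  most \<open>r * C\<close>. The good part \<open>i\<close> yields at most its trace size plus
  \<open>C\<close>, and the traces are disjoint pieces of \<open>X\<close>, so their sizes average
  to at most \<open>k / r\<close>.\<close>

lemma sum_val_le:
  assumes "X \<subseteq> slots" "card X \<le> k"
  shows "(\<Sum>i<r. val i X) \<le> real r * (real k / real u * (real k + real r * C) + real r * C + real k / real r + C)"
proof -
  have un: "unmasked i X \<le> real (card (trace i X)) + C + real r * C" if "i < r" for i
  proof -
    have "(\<Sum>j\<in>{..<r} - {i}. cov {..<k} w (trace j X)) \<le> (\<Sum>j\<in>{..<r} - {i}. C)"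
      by (intro sum_mono cov_w_le trace_subset assms)
    also have "\<dots> \<le> real r * C" using C_nonneg that by (simp add: mult_right_mono)
    finally show ?thesis
      using g_le[OF trace_subset[OF assms(1)], of i]
      by (simp add: unmasked_def sum_weight_split[OF that])
  qed
  have "val i X \<le> real k / real u * (real k + real r * C) + (real (card (trace i X)) + C + real r * C)"
    if "i < r" for i
    unfolding val_def
  proof (rule add_mono)
    have "real (card (hit X)) \<le> real k" using card_hit_le(2)[OF assms(1)] assms(2) by simp
    then show "real (card (hit X)) / real u * total \<le> real k / real u * (real k + real r * C)"
      using total_le total_nonneg pos by (intro mult_mono divide_right_mono) auto
    have "(1 - real (card (hit X)) / real u) * unmasked i X \<le> 1 * unmasked i X"
      by (intro mult_right_mono unmasked_nonneg) simp
    with un[OF that] show "(1 - real (card (hit X)) / real u) * unmasked i X \<le> real (card (trace i X)) + C + real r * C"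
      by simp
  qed
  then have "(\<Sum>i<r. val i X) \<le>
      (\<Sum>i<r. real k / real u * (real k + real r * C) + (real (card (trace i X)) + C + real r * C))"
    by (intro sum_mono) auto
  also have "\<dots> = real r * (real k / real u * (real k + real r * C) + C + real r * C) + real (\<Sum>i<r. card (trace i X))"
    by (simp add: sum.distrib algebra_simps)
  also have "real (\<Sum>i<r. card (trace i X)) \<le> real k"
    using sum_card_trace_le[OF assms(1)] assms(2) by linarith
  finally show ?thesis using pos by (simp add: algebra_simps)
qed

section \<open>Probability bounds for the random placement\<close>

lemma Max_val_ge:
  assumes "slots \<subseteq> \<theta> ` ground n" "i < r"
  shows "real k \<le> Max ((\<lambda>S. val i (\<theta> ` S)) ` card_constraint n k)"
proof -
  have "parts {i} \<subseteq> slots" using assms(2) by (auto simp: parts_def slots_def)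
  then have "parts {i} \<subseteq> \<theta> ` ground n" using assms(1) by blast
  \<comment> \<open>One ground element is chosen per slot of part \<open>i\<close>, so
    \<open>S\<close> has exactly \<open>k\<close> elements.\<close>
  then obtain S where S: "S \<subseteq> ground n" "inj_on \<theta> S" "parts {i} = \<theta> ` S"
    unfolding subset_image_inj by blast
  have "card S = card (parts {i})" using S by (simp add: card_image)
  also have "\<dots> = k" by (simp add: parts_def card_image card_cartesian_product)
  finally have "S \<in> card_constraint n k" using S by (simp add: card_constraint_def)
  then have "val i (\<theta> ` S) \<le> Max ((\<lambda>S. val i (\<theta> ` S)) ` card_constraint n k)"
    using finite_card_constraint by (intro Max_ge) auto
  then show ?thesis using val_parts_ge[OF assms(2)] S by simp
qed

text \<open>Union bound over the slots, each of which is missed by all \<open>n\<close> independent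
  choices with probability \<open>(1 - 1 / card slots) ^ n\<close>.\<close>

lemma card_not_surjective_le:
  "real (card {\<theta>\<in>PiE (ground n) (\<lambda>_. slots). \<not> slots \<subseteq> \<theta> ` ground n}) \<le>
    real (card slots) * (1 - 1 / real (card slots)) ^ n * real (card (PiE (ground n) (\<lambda>_. slots)))"
proof -
  define \<Theta> where "\<Theta> = PiE (ground n) (\<lambda>_. slots)"
  have fin: "finite \<Theta>" unfolding \<Theta>_def by (intro finite_PiE finite_slots) (simp add: ground_def)
  have "{\<theta>\<in>\<Theta>. \<not> slots \<subseteq> \<theta> ` ground n} \<subseteq> (\<Union>s\<in>slots. {\<theta>\<in>\<Theta>. \<theta> ` ground n \<inter> {s} = {}})"
    by auto
  then have "card {\<theta>\<in>\<Theta>. \<not> slots \<subseteq> \<theta> ` ground n} \<le> (\<Sum>s\<in>slots. card {\<theta>\<in>\<Theta>. \<theta> ` ground n \<inter> {s} = {}})"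
    using fin finite_slots by (intro order.trans[OF card_mono card_UN_le]) auto
  then have "real (card {\<theta>\<in>\<Theta>. \<not> slots \<subseteq> \<theta> ` ground n}) \<le> (\<Sum>s\<in>slots. real (card {\<theta>\<in>\<Theta>. \<theta> ` ground n \<inter> {s} = {}}))"
    unfolding of_nat_sum[symmetric] of_nat_le_iff .
  also have "\<dots> = (\<Sum>s\<in>slots. (1 - 1 / real (card slots)) ^ n * real (card \<Theta>))"
  proof (rule sum.cong[OF refl])
    fix s assume "s \<in> slots"
    then show "real (card {\<theta>\<in>\<Theta>. \<theta> ` ground n \<inter> {s} = {}}) = (1 - 1 / real (card slots)) ^ n * real (card \<Theta>)"
      using card_PiE_const_avoid[of "ground n" slots "ground n" "{s}"] finite_slots
      by (auto simp: \<Theta>_def ground_def)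
  qed
  finally show ?thesis by (simp add: \<Theta>_def)
qed

text \<open>The threshold \<open>s\<close> separates two regimes. A set of at least \<open>s\<close>
  elements can distinguish only if it misses some block, which the first term bounds. A smaller one
  can distinguish only if it meets some part in more than \<open>l\<close> slots, which the second
  term bounds.\<close>

lemma card_distinguishing_le:
  assumes "S \<subseteq> ground n"
  shows "real (card {\<theta>\<in>PiE (ground n) (\<lambda>_. slots). \<exists>i<r. \<exists>j<r. val i (\<theta> ` S) \<noteq> val j (\<theta> ` S)}) \<le>
    (real u * (1 - real b / real (card slots)) ^ s + real r * (real s * real k / real (card slots)) ^ Suc l)
      * real (card (PiE (ground n) (\<lambda>_. slots)))"
    (is "real (card ?D) \<le> (?p + ?q) * real ?c")
proof -
  define \<Theta> where "\<Theta> = PiE (ground n) (\<lambda>_. slots)"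
  have G: "finite (ground n)" by (simp add: ground_def)
  have fin: "finite \<Theta>" unfolding \<Theta>_def by (intro finite_PiE finite_slots G)
  have img: "\<theta> ` S \<subseteq> slots" if "\<theta> \<in> \<Theta>" for \<theta>
    using that assms unfolding \<Theta>_def PiE_iff by blast
  have block: "block a \<subseteq> slots" "card (block a) = b" if "a < u" for a
    using that by (auto simp: block_def slots_def card_image card_cartesian_product)
  have part: "parts {j} \<subseteq> slots" "card (parts {j}) = k" if "j < r" for j
    using that by (auto simp: parts_def slots_def card_image card_cartesian_product)
  \<comment> \<open>This keeps the base of the first power nonnegative, so that the power decreases
    as the sample grows beyond \<open>s\<close>.\<close>
  have b_le: "real b / real (card slots) \<le> 1"
    using block[of 0] pos finite_slots card_mono[of slots "block 0"]
    by (simp add: divide_le_eq_1)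
  have p: "0 \<le> ?p" using b_le by simp
  have q: "0 \<le> ?q" by (intro mult_nonneg_nonneg zero_le_power divide_nonneg_nonneg) auto
  show ?thesis
  proof (cases "s \<le> card S")
    case True
    have "?D \<subseteq> (\<Union>a<u. {\<theta>\<in>\<Theta>. \<theta> ` S \<inter> block a = {}})"
    proof
      fix \<theta> assume "\<theta> \<in> ?D"
      then have \<theta>: "\<theta> \<in> \<Theta>" "\<exists>i<r. \<exists>j<r. val i (\<theta> ` S) \<noteq> val j (\<theta> ` S)"
        by (auto simp: \<Theta>_def)
      have "hit (\<theta> ` S) \<noteq> {..<u}"
        using \<theta>(2) val_eq_of_masked[of "\<theta> ` S"] by force
      then obtain a where a: "a < u" "a \<notin> hit (\<theta> ` S)"
        using hit_subset[OF img[OF \<theta>(1)]] by blast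
      moreover have "X \<inter> block a = {}" if "a \<notin> hit X" for X
        using that by (auto simp: hit_def block_def)
      ultimately have "\<theta> ` S \<inter> block a = {}" by blast
      with a \<theta> show "\<theta> \<in> (\<Union>a<u. {\<theta>\<in>\<Theta>. \<theta> ` S \<inter> block a = {}})" by blast
    qed
    then have "card ?D \<le> (\<Sum>a<u. card {\<theta>\<in>\<Theta>. \<theta> ` S \<inter> block a = {}})"
      using fin by (intro order.trans[OF card_mono card_UN_le]) auto
    then have "real (card ?D) \<le> (\<Sum>a<u. real (card {\<theta>\<in>\<Theta>. \<theta> ` S \<inter> block a = {}}))"
      unfolding of_nat_sum[symmetric] of_nat_le_iff .
    also have "\<dots> = (\<Sum>a<u. (1 - real b / real (card slots)) ^ card S * real (card \<Theta>))"
      using card_PiE_const_avoid[OF G finite_slots assms _ slots_nonempty] block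
      by (intro sum.cong refl) (auto simp: \<Theta>_def)
    also have "\<dots> = real u * (1 - real b / real (card slots)) ^ card S * real (card \<Theta>)" by simp
    also have "\<dots> \<le> ?p * real (card \<Theta>)"
      using b_le True by (intro mult_left_mono mult_right_mono power_decreasing) auto
    also have "\<dots> \<le> (?p + ?q) * real (card \<Theta>)"
      using q by (intro mult_right_mono) auto
    finally show ?thesis by (simp add: \<Theta>_def)
  next
    case False
    have "?D \<subseteq> (\<Union>j<r. {\<theta>\<in>\<Theta>. Suc l \<le> card (\<theta> ` S \<inter> parts {j})})"
    proof
      fix \<theta> assume "\<theta> \<in> ?D"
      then have \<theta>: "\<theta> \<in> \<Theta>" "\<exists>i<r. \<exists>j<r. val i (\<theta> ` S) \<noteq> val j (\<theta> ` S)"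
        by (auto simp: \<Theta>_def)
      note X = img[OF \<theta>(1)]
      have "\<exists>j<r. \<not> card (trace j (\<theta> ` S)) \<le> l"
      proof (rule ccontr)
        assume "\<not> ?thesis"
        then have "unmasked i (\<theta> ` S) = (\<Sum>j<r. cov {..<k} w (trace j (\<theta> ` S)))" if "i < r" for i
          using unmasked_eq_of_small_traces[OF X that] by blast
        then have "val i (\<theta> ` S) = val j (\<theta> ` S)" if "i < r" "j < r" for i j
          using that by (simp add: val_def)
        with \<theta>(2) show False by blast
      qed
      then obtain j where j: "j < r" "Suc l \<le> card (trace j (\<theta> ` S))" by (auto simp: not_le)
      have "\<theta> ` S \<inter> parts {j} = (\<lambda>x. Inl (j, x)) ` trace j (\<theta> ` S)"
        if "trace j Z \<subseteq> {..<k}" "Z = \<theta> ` S" for Z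
        using that(1) unfolding that(2)[symmetric] by (auto simp: trace_def parts_def)
      from this[OF trace_subset[OF X] refl] have "card (\<theta> ` S \<inter> parts {j}) = card (trace j (\<theta> ` S))"
        by (simp add: card_image inj_on_def)
      with j \<theta>(1) show "\<theta> \<in> (\<Union>j<r. {\<theta>\<in>\<Theta>. Suc l \<le> card (\<theta> ` S \<inter> parts {j})})"
        by (intro UN_I[of j]) simp_all
    qed
    then have "card ?D \<le> (\<Sum>j<r. card {\<theta>\<in>\<Theta>. Suc l \<le> card (\<theta> ` S \<inter> parts {j})})"
      using fin by (intro order.trans[OF card_mono card_UN_le]) auto
    then have "real (card ?D) \<le> (\<Sum>j<r. real (card {\<theta>\<in>\<Theta>. Suc l \<le> card (\<theta> ` S \<inter> parts {j})}))"
      unfolding of_nat_sum[symmetric] of_nat_le_iff .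
    also have "\<dots> \<le> (\<Sum>j<r. (real s * real k / real (card slots)) ^ Suc l * real (card \<Theta>))"
    proof (rule sum_mono)
      fix j assume "j \<in> {..<r}"
      then have j: "j < r" by simp
      have "real (card {\<theta>\<in>\<Theta>. Suc l \<le> card (\<theta> ` S \<inter> parts {j})}) \<le>
          (real (card S) * real k / real (card slots)) ^ Suc l * real (card \<Theta>)"
        using card_PiE_const_many_hits[OF G finite_slots assms part(1)[OF j] slots_nonempty]
        unfolding part(2)[OF j] \<Theta>_def .
      also have "\<dots> \<le> (real s * real k / real (card slots)) ^ Suc l * real (card \<Theta>)"
        using False by (intro mult_right_mono power_mono divide_right_mono) auto
      finally show "real (card {\<theta>\<in>\<Theta>. Suc l \<le> card (\<theta> ` S \<inter> parts {j})}) \<le>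
          (real s * real k / real (card slots)) ^ Suc l * real (card \<Theta>)" .
    qed
    also have "\<dots> = ?q * real (card \<Theta>)" by simp
    also have "\<dots> \<le> (?p + ?q) * real (card \<Theta>)"
      using p by (intro mult_right_mono) auto
    finally show ?thesis by (simp add: \<Theta>_def)
  qed
qed

text \<open>The averaging argument for a uniformly random placement: \<open>k\<close> is a lower
  bound for the optimum when the placement is onto, \<open>\<eta>1\<close> bounds the probability
  that it is not onto, and \<open>\<eta>2\<close> the probability that a given sample
  distinguishes.\<close>

lemma not_optimizable:
  assumes "set_pmf D \<subseteq> Pow (ground n)" "0 < \<alpha>" "P (card children)"
    and W: "W = real k / real u * (real k + real r * C) + real r * C + real k / real r + C"
    and \<eta>1: "\<eta>1 = real (card slots) * (1 - 1 / real (card slots)) ^ n"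
    and \<eta>2: "\<eta>2 = real u * (1 - real b / real (card slots)) ^ s + real r * (real s * real k / real (card slots)) ^ Suc l"
    and "W / (\<alpha> * real k) + \<eta>1 + real m * \<eta>2 < 1 - \<delta>"
  shows "\<not> optimizable_from_samples n {f. coverage_with n P f} D k \<alpha> m \<delta>"
proof (rule not_optimizable_from_samplesI[where \<Theta> = "PiE (ground n) (\<lambda>_. slots)" and r = r
      and f = "\<lambda>\<theta> i S. val i (\<theta> ` S)" and V = "real k" and W = W and ?\<eta>1.0 = \<eta>1 and ?\<eta>2.0 = \<eta>2])
  have img: "\<theta> ` S \<subseteq> slots" if "\<theta> \<in> PiE (ground n) (\<lambda>_. slots)" "S \<subseteq> ground n" for \<theta> S
    using that unfolding PiE_iff by blast
  have fin: "finite (PiE (ground n) (\<lambda>_. slots))"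
    by (intro finite_PiE finite_slots) (simp add: ground_def)
  show "PiE (ground n) (\<lambda>_. slots) \<noteq> {}" using slots_nonempty by (simp add: PiE_eq_empty_iff)
  show "finite (PiE (ground n) (\<lambda>_. slots))" by (rule fin)
  show "(\<lambda>S. val i (\<theta> ` S)) \<in> {f. coverage_with n P f}"
    if "\<theta> \<in> PiE (ground n) (\<lambda>_. slots)" "i < r" for \<theta> i
    using coverage_with_val[OF that(2)] that(1) assms(3) by (auto simp: PiE_iff)
  show "0 \<le> val i (\<theta> ` S)"
    if "\<theta> \<in> PiE (ground n) (\<lambda>_. slots)" "i < r" "S \<in> card_constraint n k" for \<theta> i S
    using that by (intro val_nonneg img) (auto simp: card_constraint_def)
  show "(\<Sum>i<r. val i (\<theta> ` S)) \<le> real r * W"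
    if "\<theta> \<in> PiE (ground n) (\<lambda>_. slots)" "S \<in> card_constraint n k" for \<theta> S
  proof -
    have S: "S \<subseteq> ground n" "card S \<le> k" using that by (auto simp: card_constraint_def)
    have "finite S" using S(1) by (rule finite_subset) (simp add: ground_def)
    then have "card (\<theta> ` S) \<le> k" using card_image_le[of S \<theta>] S(2) by simp
    then show ?thesis unfolding W by (intro sum_val_le img that S)
  qed
  have "card {\<theta> \<in> PiE (ground n) (\<lambda>_. slots). \<exists>i<r. Max ((\<lambda>S. val i (\<theta> ` S)) ` card_constraint n k) < real k}
      \<le> card {\<theta> \<in> PiE (ground n) (\<lambda>_. slots). \<not> slots \<subseteq> \<theta> ` ground n}"
    using fin Max_val_ge by (intro card_mono) (auto simp: not_le[symmetric])
  then show "real (card {\<theta> \<in> PiE (ground n) (\<lambda>_. slots). \<exists>i<r. Max ((\<lambda>S. val i (\<theta> ` S)) ` card_constraint n k) < real k})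
      \<le> \<eta>1 * real (card (PiE (ground n) (\<lambda>_. slots)))"
    unfolding \<eta>1 using card_not_surjective_le[of n] by linarith
  show "real (card {\<theta> \<in> PiE (ground n) (\<lambda>_. slots). \<exists>i<r. \<exists>j<r. val i (\<theta> ` S) \<noteq> val j (\<theta> ` S)})
      \<le> \<eta>2 * real (card (PiE (ground n) (\<lambda>_. slots)))" if "S \<subseteq> ground n" for S
    unfolding \<eta>2 by (rule card_distinguishing_le[OF that])
qed (use assms pos in auto)

end

section \<open>Asymptotics\<close>

lemma one_minus_power_le_exp:
  fixes p :: real
  assumes "p \<le> 1"
  shows "(1 - p) ^ q \<le> exp (- (p * real q))"
proof -
  have "(1 - p) ^ q \<le> exp (- p) ^ q"
    using assms exp_ge_add_one_self[of "- p"] by (intro power_mono) auto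
  then show ?thesis by (simp add: exp_of_nat_mult[symmetric] mult.commute)
qed

text \<open>With blocks of size \<open>\<kappa>^2 * t^2\<close> the number of slots lies between
  \<open>Z / 2\<close> and \<open>Z\<close>. The factor \<open>t\<close> is the gap between the two
  regimes of sample sizes: it makes large samples miss a block, and small samples crowd a part, only
  rarely.\<close>

lemma masked_parts_not_optimizable:
  fixes \<kappa> t l n m :: nat and C \<alpha> \<delta> :: real
  defines "Z \<equiv> 2 * real \<kappa> ^ 5 * real t ^ 2"
  assumes mp: "masked_parts \<kappa> (\<kappa> ^ 2) (\<kappa> ^ 3) (\<kappa> ^ 2 * t ^ 2) l g w C"
    and D: "set_pmf D \<subseteq> Pow (ground n)" and "0 < \<alpha>"
    and P: "P (\<kappa> ^ 4 * card {A. A \<subseteq> {..<\<kappa> ^ 2} \<and> A \<noteq> {} \<and> (g A \<noteq> 0 \<or> w A \<noteq> 0)})"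
    and small: "(2 + 3 * C) / (\<alpha> * real \<kappa>) + Z * exp (- (real n / Z))
      + real m * (real \<kappa> ^ 3 * exp (- (real t / 2)) + real \<kappa> / real t ^ Suc l) < 1 - \<delta>"
  shows "\<not> optimizable_from_samples n {f. coverage_with n P f} D (\<kappa> ^ 2) \<alpha> m \<delta>"
proof -
  interpret masked_parts \<kappa> "\<kappa> ^ 2" "\<kappa> ^ 3" "\<kappa> ^ 2 * t ^ 2" l g w C by (rule mp)
  have \<kappa>: "1 \<le> real \<kappa>" and t: "1 \<le> real t" using pos by auto
  define x y where "x = real \<kappa>" and "y = real t"
  have xy: "1 \<le> x" "1 \<le> y" using \<kappa> t by (auto simp: x_def y_def)
  define N where "N = real (card slots)"
  \<comment> \<open>At this size a sample has on average at least \<open>t / 2\<close> hits in each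
    block and at most \<open>1 / t\<close> in each part.\<close>
  define s where "s = \<kappa> ^ 3 * t"
  have N: "N = x ^ 3 + x ^ 5 * y ^ 2"
    unfolding N_def card_slots by (simp add: x_def y_def power_numeral_reduce)
  have Z: "Z = 2 * x ^ 5 * y ^ 2" by (simp add: Z_def x_def y_def)
  have "x ^ 3 * 1 \<le> x ^ 5 * y ^ 2"
    using xy by (intro mult_mono power_increasing one_le_power) auto
  then have N_le: "N \<le> Z" unfolding N Z by linarith
  have N_ge: "x ^ 5 * y ^ 2 \<le> N" using xy by (simp add: N)
  have pos': "0 < x ^ 5 * y ^ 2" using xy by simp
  have N_pos: "1 \<le> N"
    using N_ge mult_mono[of 1 "x ^ 5" 1 "y ^ 2"] xy by (simp add: one_le_power)
  have "card children = \<kappa> ^ 4 * card {A. A \<subseteq> {..<\<kappa> ^ 2} \<and> A \<noteq> {} \<and> (g A \<noteq> 0 \<or> w A \<noteq> 0)}"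
    unfolding card_children supp_def by (simp add: power_numeral_reduce mult_ac)
  then have P': "P (card children)" using P by simp
  show ?thesis
  proof (rule not_optimizable[where P = P and s = s, OF D \<open>0 < \<alpha>\<close> P' refl refl refl])
    have hit: "real (card slots) * (1 - 1 / real (card slots)) ^ n \<le> Z * exp (- (real n / Z))"
    proof -
      have "(1 - 1 / N) ^ n \<le> exp (- (1 / N * real n))"
        using N_pos by (intro one_minus_power_le_exp) simp
      also have "\<dots> \<le> exp (- (real n / Z))"
        using N_le N_pos by (auto intro!: divide_left_mono)
      finally show ?thesis
        unfolding N_def[symmetric] using N_le N_pos by (intro mult_mono) auto
    qed
    have mask: "(1 - real (\<kappa> ^ 2 * t ^ 2) / real (card slots)) ^ s \<le> exp (- (y / 2))"
    proof -
      have b: "real (\<kappa> ^ 2 * t ^ 2) = x ^ 2 * y ^ 2" by (simp add: x_def y_def)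
      have "x ^ 2 * y ^ 2 \<le> x ^ 5 * y ^ 2"
        using xy by (intro mult_right_mono power_increasing) auto
      then have "x ^ 2 * y ^ 2 / N \<le> 1" using N_ge N_pos by (simp add: divide_le_eq_1)
      then have "(1 - x ^ 2 * y ^ 2 / N) ^ s \<le> exp (- (x ^ 2 * y ^ 2 / N * real s))"
        by (rule one_minus_power_le_exp)
      also have "x ^ 2 * y ^ 2 / N * real s = x ^ 5 * y ^ 3 / N"
        by (simp add: s_def x_def y_def power_numeral_reduce)
      also have "exp (- (x ^ 5 * y ^ 3 / N)) \<le> exp (- (y / 2))"
      proof -
        have "y / 2 = x ^ 5 * y ^ 3 / Z" using xy by (simp add: Z field_simps power_numeral_reduce)
        also have "\<dots> \<le> x ^ 5 * y ^ 3 / N"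
          using N_le N_pos xy by (intro divide_left_mono) auto
        finally show ?thesis by simp
      qed
      finally show ?thesis unfolding b N_def[symmetric] .
    qed
    have spread: "(real s * real (\<kappa> ^ 2) / real (card slots)) ^ Suc l \<le> 1 / y ^ Suc l"
    proof -
      have "real s * real (\<kappa> ^ 2) / N = x ^ 5 * y / N"
        by (simp add: s_def x_def y_def power_numeral_reduce)
      also have "x ^ 5 * y / N \<le> x ^ 5 * y / (x ^ 5 * y ^ 2)"
        using N_ge pos' N_pos xy by (intro divide_left_mono) auto
      also have "\<dots> = 1 / y" using xy by (simp add: power2_eq_square)
      finally have "(real s * real (\<kappa> ^ 2) / N) ^ Suc l \<le> (1 / y) ^ Suc l"
        using N_pos by (intro power_mono) simp_all
      then show ?thesis unfolding N_def[symmetric] by (simp add: power_one_over)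
    qed
    \<comment> \<open>The average value is at most of order \<open>\<kappa>\<close>, against an
      optimum of at least \<open>\<kappa>^2\<close>.\<close>
    have ratio: "(real (\<kappa> ^ 2) / real (\<kappa> ^ 3) * (real (\<kappa> ^ 2) + real \<kappa> * C) + real \<kappa> * C
        + real (\<kappa> ^ 2) / real \<kappa> + C) / (\<alpha> * real (\<kappa> ^ 2)) \<le> (2 + 3 * C) / (\<alpha> * real \<kappa>)"
    proof -
      have "real (\<kappa> ^ 2) / real (\<kappa> ^ 3) * (real (\<kappa> ^ 2) + real \<kappa> * C) + real \<kappa> * C
        + real (\<kappa> ^ 2) / real \<kappa> + C = 2 * x + x * C + 2 * C"
        using xy by (simp add: x_def[symmetric] power_numeral_reduce field_simps)
      also have "\<dots> \<le> x * (2 + 3 * C)"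
        using mult_right_mono[OF xy(1) C_nonneg] by (simp add: algebra_simps)
      finally have "(real (\<kappa> ^ 2) / real (\<kappa> ^ 3) * (real (\<kappa> ^ 2) + real \<kappa> * C) + real \<kappa> * C
        + real (\<kappa> ^ 2) / real \<kappa> + C) / (\<alpha> * real (\<kappa> ^ 2)) \<le> x * (2 + 3 * C) / (\<alpha> * real (\<kappa> ^ 2))"
        using \<open>0 < \<alpha>\<close> by (intro divide_right_mono) auto
      also have "\<dots> = (2 + 3 * C) / (\<alpha> * real \<kappa>)"
        using xy \<open>0 < \<alpha>\<close> by (simp add: x_def power2_eq_square)
      finally show ?thesis .
    qed
    have "real m * (real (\<kappa> ^ 3) * (1 - real (\<kappa> ^ 2 * t ^ 2) / real (card slots)) ^ s +
        real \<kappa> * (real s * real (\<kappa> ^ 2) / real (card slots)) ^ Suc l)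
      \<le> real m * (real (\<kappa> ^ 3) * exp (- (y / 2)) + real \<kappa> * (1 / y ^ Suc l))"
      using mask spread by (intro mult_left_mono add_mono) auto
    also have "\<dots> = real m * (real \<kappa> ^ 3 * exp (- (real t / 2)) + real \<kappa> / real t ^ Suc l)"
      by (simp add: y_def)
    finally show "(real (\<kappa> ^ 2) / real (\<kappa> ^ 3) * (real (\<kappa> ^ 2) + real \<kappa> * C) + real \<kappa> * C
        + real (\<kappa> ^ 2) / real \<kappa> + C) / (\<alpha> * real (\<kappa> ^ 2)) +
      real (card slots) * (1 - 1 / real (card slots)) ^ n +
      real m * (real (\<kappa> ^ 3) * (1 - real (\<kappa> ^ 2 * t ^ 2) / real (card slots)) ^ s +
        real \<kappa> * (real s * real (\<kappa> ^ 2) / real (card slots)) ^ Suc l) < 1 - \<delta>"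
      using small hit ratio by linarith
  qed
qed

text \<open>The quantifier order is the point: \<open>C\<close> depends only on \<open>l\<close>, so
  \<open>\<kappa>\<close>, \<open>t\<close> and \<open>n\<close> may grow while it stays fixed.
  \<open>P\<close> is required for all sizes up to a bound because the universe size is only known
  from above.\<close>

lemma ex_gadget_not_optimizable:
  assumes "l > 0"
  shows "\<exists>C\<ge>0. \<forall>\<kappa> t n m \<alpha> \<delta> D P.
      0 < \<kappa> \<longrightarrow> 0 < t \<longrightarrow> 0 < \<alpha> \<longrightarrow> set_pmf D \<subseteq> Pow (ground n) \<longrightarrow>
      (\<forall>q \<le> \<kappa> ^ 4 * (2 * ((\<kappa> ^ 2 + 1) ^ l + 1) + \<kappa> ^ 2). P q) \<longrightarrow>
      (2 + 3 * C) / (\<alpha> * real \<kappa>)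
        + 2 * real \<kappa> ^ 5 * real t ^ 2 * exp (- (real n / (2 * real \<kappa> ^ 5 * real t ^ 2)))
        + real m * (real \<kappa> ^ 3 * exp (- (real t / 2)) + real \<kappa> / real t ^ Suc l) < 1 - \<delta> \<longrightarrow>
      \<not> optimizable_from_samples n {f. coverage_with n P f} D (\<kappa> ^ 2) \<alpha> m \<delta>"
proof -
  obtain C where C: "0 \<le> C" "\<And>k. \<exists>g b :: nat set \<Rightarrow> real.
     (\<forall>A. A \<subseteq> {..<k} \<longrightarrow> 0 \<le> g A \<and> 0 \<le> b A) \<and>
     (\<forall>X. X \<subseteq> {..<k} \<longrightarrow> card X \<le> l \<longrightarrow> cov {..<k} g X = cov {..<k} b X) \<and>
     cov {..<k} b {..<k} \<le> C \<and>
     (\<forall>X. X \<subseteq> {..<k} \<longrightarrow> cov {..<k} g X \<le> real (card X) + C) \<and>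
     real k \<le> cov {..<k} g {..<k} \<and>
     card {A. A \<subseteq> {..<k} \<and> (g A \<noteq> 0 \<or> b A \<noteq> 0)} \<le> 2 * ((k + 1) ^ l + 1) + k"
    using ex_good_bad_weights[OF assms] by blast
  show ?thesis
  proof (intro exI[of _ C] conjI allI impI C(1))
    fix \<kappa> t n m :: nat and \<alpha> \<delta> :: real and D P
    assume *: "0 < \<kappa>" "0 < t" "0 < \<alpha>" "set_pmf D \<subseteq> Pow (ground n)"
      and P: "\<forall>q \<le> \<kappa> ^ 4 * (2 * ((\<kappa> ^ 2 + 1) ^ l + 1) + \<kappa> ^ 2). P q"
      and small: "(2 + 3 * C) / (\<alpha> * real \<kappa>)
        + 2 * real \<kappa> ^ 5 * real t ^ 2 * exp (- (real n / (2 * real \<kappa> ^ 5 * real t ^ 2)))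
        + real m * (real \<kappa> ^ 3 * exp (- (real t / 2)) + real \<kappa> / real t ^ Suc l) < 1 - \<delta>"
    obtain g b :: "nat set \<Rightarrow> real" where gb:
      "\<And>A. A \<subseteq> {..<\<kappa> ^ 2} \<Longrightarrow> 0 \<le> g A" "\<And>A. A \<subseteq> {..<\<kappa> ^ 2} \<Longrightarrow> 0 \<le> b A"
      "\<And>X. X \<subseteq> {..<\<kappa> ^ 2} \<Longrightarrow> card X \<le> l \<Longrightarrow> cov {..<\<kappa> ^ 2} g X = cov {..<\<kappa> ^ 2} b X"
      "cov {..<\<kappa> ^ 2} b {..<\<kappa> ^ 2} \<le> C"
      "\<And>X. X \<subseteq> {..<\<kappa> ^ 2} \<Longrightarrow> cov {..<\<kappa> ^ 2} g X \<le> real (card X) + C"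
      "real (\<kappa> ^ 2) \<le> cov {..<\<kappa> ^ 2} g {..<\<kappa> ^ 2}"
      "card {A. A \<subseteq> {..<\<kappa> ^ 2} \<and> (g A \<noteq> 0 \<or> b A \<noteq> 0)} \<le> 2 * ((\<kappa> ^ 2 + 1) ^ l + 1) + \<kappa> ^ 2"
      using C(2)[of "\<kappa> ^ 2"] by (elim exE conjE) (rule that, simp_all)
    have mp: "masked_parts \<kappa> (\<kappa> ^ 2) (\<kappa> ^ 3) (\<kappa> ^ 2 * t ^ 2) l g b C"
      by unfold_locales (use gb * in simp_all)
    have "card {A. A \<subseteq> {..<\<kappa> ^ 2} \<and> A \<noteq> {} \<and> (g A \<noteq> 0 \<or> b A \<noteq> 0)}
        \<le> card {A. A \<subseteq> {..<\<kappa> ^ 2} \<and> (g A \<noteq> 0 \<or> b A \<noteq> 0)}"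
      by (rule card_mono) auto
    then show "\<not> optimizable_from_samples n {f. coverage_with n P f} D (\<kappa> ^ 2) \<alpha> m \<delta>"
      using gb(7) by (intro masked_parts_not_optimizable[OF mp *(4,3) _ small] P[rule_format] mult_le_mono2) linarith
  qed
qed

text \<open>The slack \<open>n powr a\<close> is spent on \<open>t\<close>. Then \<open>Z\<close> is
  at most \<open>2 * n powr (1 - 3 * a)\<close>, which makes the placement onto with high
  probability. The sample exponent \<open>c\<close> enters only through \<open>l\<close>, so the
  constraint \<open>\<kappa> n ^ 2\<close> is the same for all \<open>c\<close> and
  \<open>\<delta>\<close>.\<close>

lemma eventually_not_optimizable:
  fixes \<kappa> :: "nat \<Rightarrow> nat" and \<alpha> :: "nat \<Rightarrow> real" and a \<delta> :: real
  assumes a: "0 < a"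
    and \<kappa>: "\<forall>\<^sub>F n in sequentially. real (\<kappa> n) \<le> real n powr (1 / 5 - a)"
    and \<alpha>: "\<And>n. 0 \<le> \<alpha> n" "filterlim (\<lambda>n. \<alpha> n * real (\<kappa> n)) at_top sequentially"
    and P: "\<And>l. \<forall>\<^sub>F n in sequentially. \<forall>q \<le> \<kappa> n ^ 4 * (2 * ((\<kappa> n ^ 2 + 1) ^ l + 1) + \<kappa> n ^ 2). P n q"
    and \<delta>: "\<delta> < 1"
  shows "\<forall>\<^sub>F n in sequentially. \<forall>D :: nat set pmf. set_pmf D \<subseteq> Pow (ground n) \<longrightarrow>
     (\<forall>m \<le> n ^ c. \<not> optimizable_from_samples n {f. coverage_with n (P n) f} D (\<kappa> n ^ 2) (\<alpha> n) m \<delta>)"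
proof -
  \<comment> \<open>This makes \<open>t ^ Suc l\<close> at least of order
    \<open>n powr (c + 2)\<close>: it beats the \<open>n ^ c\<close> samples and the factor
    \<open>\<kappa> \<le> n\<close>, and leaves a factor \<open>1 / n\<close>.\<close>
  obtain l0 :: nat where l0: "(real c + 2) / a < real l0" using reals_Archimedean2 by blast
  define l where "l = Suc l0"
  have "l > 0" by (simp add: l_def)
  have l: "real c + 2 \<le> a * real (Suc l)"
  proof -
    have "real c + 2 < a * real l0" using l0 a by (simp add: field_simps)
    also have "\<dots> \<le> a * real (Suc l)" using a by (simp add: l_def)
    finally show ?thesis by simp
  qed
  obtain C where C: "0 \<le> C" "\<forall>\<kappa> t n m \<alpha> \<delta> D P.
      0 < \<kappa> \<longrightarrow> 0 < t \<longrightarrow> 0 < \<alpha> \<longrightarrow> set_pmf D \<subseteq> Pow (ground n) \<longrightarrow>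
      (\<forall>q \<le> \<kappa> ^ 4 * (2 * ((\<kappa> ^ 2 + 1) ^ l + 1) + \<kappa> ^ 2). P q) \<longrightarrow>
      (2 + 3 * C) / (\<alpha> * real \<kappa>)
        + 2 * real \<kappa> ^ 5 * real t ^ 2 * exp (- (real n / (2 * real \<kappa> ^ 5 * real t ^ 2)))
        + real m * (real \<kappa> ^ 3 * exp (- (real t / 2)) + real \<kappa> / real t ^ Suc l) < 1 - \<delta> \<longrightarrow>
      \<not> optimizable_from_samples n {f. coverage_with n P f} D (\<kappa> ^ 2) \<alpha> m \<delta>"
    using ex_gadget_not_optimizable[OF \<open>l > 0\<close>] by (elim exE conjE)
  define X where "X n = 2 * real n powr (1 - 3 * a)" for n :: nat
  define err where "err n = (2 + 3 * C) / (\<alpha> n * real (\<kappa> n)) + X n * exp (- (real n / X n))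
    + (real n powr (real c + 1) * exp (- (real n powr a / 4)) + 2 ^ Suc l / real n)" for n :: nat
  have "err \<longlonglongrightarrow> 0 + 0 + (0 + 0)"
    unfolding err_def
  proof (intro tendsto_add)
    show "(\<lambda>n. (2 + 3 * C) / (\<alpha> n * real (\<kappa> n))) \<longlonglongrightarrow> 0"
      by (rule real_tendsto_divide_at_top[OF tendsto_const \<alpha>(2)])
    show "(\<lambda>n. X n * exp (- (real n / X n))) \<longlonglongrightarrow> 0"
      unfolding X_def using a by real_asymp
    show "(\<lambda>n. real n powr (real c + 1) * exp (- (real n powr a / 4))) \<longlonglongrightarrow> 0"
      using a by real_asymp
    show "(\<lambda>n. 2 ^ Suc l / real n) \<longlonglongrightarrow> 0"
      by real_asymp
  qed
  then have "\<forall>\<^sub>F n in sequentially. err n < 1 - \<delta>"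
    using \<delta> by (intro order_tendstoD(2)[of err 0]) auto
  moreover have "\<forall>\<^sub>F n in sequentially. 0 < \<alpha> n * real (\<kappa> n)"
    using \<alpha>(2) by (simp add: filterlim_at_top_dense)
  ultimately show ?thesis using \<kappa> P[of l] eventually_ge_at_top[of 1]
  proof eventually_elim
    case (elim n)
    define N where "N = real n"
    have N: "1 \<le> N" using elim by (simp add: N_def)
    have \<kappa>_pos: "0 < \<kappa> n" and \<alpha>_pos: "0 < \<alpha> n"
      using elim(2) \<alpha>(1)[of n] by (auto simp: zero_less_mult_iff)
    \<comment> \<open>Rounding loses at most a factor 2, which accounts for the constants
      \<open>1 / 4\<close> and \<open>2 ^ Suc l\<close> in \<open>err\<close>.\<close>
    define t where "t = nat \<lfloor>N powr a\<rfloor>"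
    have Na: "1 \<le> N powr a" using N a by (simp add: ge_one_powr_ge_zero)
    then have "0 < t" by (simp add: t_def)
    have t_le: "real t \<le> N powr a" using Na by (simp add: t_def)
    have t_ge: "N powr a / 2 \<le> real t"
    proof -
      have "N powr a < real t + 1" using Na unfolding t_def by linarith
      moreover have "1 \<le> real t" using \<open>0 < t\<close> by simp
      ultimately show ?thesis by simp
    qed
    have \<kappa>_pow: "real (\<kappa> n) ^ j \<le> N powr (real j * (1 / 5 - a))" for j
    proof -
      have "real (\<kappa> n) ^ j \<le> (N powr (1 / 5 - a)) ^ j"
        using elim(3) by (intro power_mono) (simp_all add: N_def)
      also have "\<dots> = N powr (real j * (1 / 5 - a))"
        using N by (simp add: powr_powr powr_realpow[symmetric] mult.commute)
      finally show ?thesis .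
    qed
    have \<kappa>_le: "real (\<kappa> n) ^ j \<le> N" if "j \<le> 5" for j
    proof -
      have "real j * (1 / 5 - a) \<le> 1"
      proof -
        have "real j * (1 / 5 - a) \<le> real j * (1 / 5)" using a by (intro mult_left_mono) auto
        also have "\<dots> \<le> 1" using that by simp
        finally show ?thesis .
      qed
      then have "N powr (real j * (1 / 5 - a)) \<le> N powr 1" using N by (intro powr_mono) auto
      then show ?thesis using \<kappa>_pow[of j] N by simp
    qed
    define Z where "Z = 2 * real (\<kappa> n) ^ 5 * real t ^ 2"
    have "Z > 0" using \<kappa>_pos \<open>0 < t\<close> by (simp add: Z_def)
    have "Z \<le> X n"
    proof -
      have "real (\<kappa> n) ^ 5 * real t ^ 2 \<le> N powr (real 5 * (1 / 5 - a)) * (N powr a) ^ 2"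
        using t_le by (intro mult_mono \<kappa>_pow power_mono) auto
      also have "(N powr a) ^ 2 = N powr (2 * a)"
        by (simp add: powr_add[symmetric] power2_eq_square)
      also have "N powr (real 5 * (1 / 5 - a)) * N powr (2 * a) = N powr (1 - 3 * a)"
        by (simp add: powr_add[symmetric] algebra_simps)
      finally show ?thesis by (simp add: Z_def X_def N_def)
    qed
    \<comment> \<open>The function \<open>z * exp (- (N / z))\<close> is increasing for positive
      \<open>z\<close>.\<close>
    have err2: "Z * exp (- (N / Z)) \<le> X n * exp (- (N / X n))"
      using \<open>Z > 0\<close> \<open>Z \<le> X n\<close> N by (intro mult_mono) (auto intro!: divide_left_mono)
    have err3: "real m * (real (\<kappa> n) ^ 3 * exp (- (real t / 2)) + real (\<kappa> n) / real t ^ Suc l)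
        \<le> N powr (real c + 1) * exp (- (N powr a / 4)) + 2 ^ Suc l / N" if m: "m \<le> n ^ c" for m
    proof -
      have "real m \<le> N ^ c" using m by (metis N_def of_nat_le_iff of_nat_power)
      also have "N ^ c = N powr real c" using N by (simp add: powr_realpow)
      finally have m': "real m \<le> N powr real c" .
      have A: "real (\<kappa> n) ^ 3 * exp (- (real t / 2)) \<le> N * exp (- (N powr a / 4))"
        using \<kappa>_le[of 3] t_ge N by (intro mult_mono) auto
      have B: "real (\<kappa> n) / real t ^ Suc l \<le> N * (2 ^ Suc l / N powr (real c + 2))"
      proof -
        have "N powr (real c + 2) \<le> N powr (a * real (Suc l))"
          using l N by (intro powr_mono) auto
        also have "\<dots> = (N powr a) ^ Suc l"
          using N by (simp add: powr_powr powr_realpow[symmetric] del: power_Suc of_nat_Suc)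
        finally have "N powr (real c + 2) / 2 ^ Suc l \<le> (N powr a / 2) ^ Suc l"
          by (simp add: power_divide divide_right_mono)
        also have "\<dots> \<le> real t ^ Suc l" using t_ge by (intro power_mono) auto
        finally have "real (\<kappa> n) / real t ^ Suc l \<le> N / (N powr (real c + 2) / 2 ^ Suc l)"
          using \<kappa>_le[of 1] N by (intro frac_le) auto
        then show ?thesis by simp
      qed
      have "real m * (real (\<kappa> n) ^ 3 * exp (- (real t / 2)) + real (\<kappa> n) / real t ^ Suc l)
          \<le> N powr real c * (N * exp (- (N powr a / 4)) + N * (2 ^ Suc l / N powr (real c + 2)))"
        using N by (intro mult_mono[OF m' add_mono[OF A B]]) auto
      also have "\<dots> = N powr (real c + 1) * exp (- (N powr a / 4)) + 2 ^ Suc l / N"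
        using N by (simp add: powr_add field_simps power2_eq_square)
      finally show ?thesis .
    qed
    show ?case
    proof (intro allI impI)
      fix D :: "nat set pmf" and m
      assume D: "set_pmf D \<subseteq> Pow (ground n)" and m: "m \<le> n ^ c"
      show "\<not> optimizable_from_samples n {f. coverage_with n (P n) f} D (\<kappa> n ^ 2) (\<alpha> n) m \<delta>"
      proof (rule C(2)[rule_format, OF \<kappa>_pos \<open>0 < t\<close> \<alpha>_pos D])
        show "P n q" if "q \<le> \<kappa> n ^ 4 * (2 * ((\<kappa> n ^ 2 + 1) ^ l + 1) + \<kappa> n ^ 2)" for q
          using elim(4) that by blast
        show "(2 + 3 * C) / (\<alpha> n * real (\<kappa> n))
          + 2 * real (\<kappa> n) ^ 5 * real t ^ 2 * exp (- (real n / (2 * real (\<kappa> n) ^ 5 * real t ^ 2)))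
          + real m * (real (\<kappa> n) ^ 3 * exp (- (real t / 2)) + real (\<kappa> n) / real t ^ Suc l) < 1 - \<delta>"
          using elim(1) err2 err3[OF m] unfolding err_def N_def Z_def by linarith
      qed
    qed
  qed
qed

text \<open>The base \<open>2 powr sqrt (log 2 n)\<close> is subpolynomial, so a constant times its
  power of degree \<open>2 * l + 6\<close> is eventually below \<open>n\<close>. Hence universe size
  \<open>n\<close> suffices for every \<open>l\<close>.\<close>

lemma eventually_universe_size_le:
  "\<forall>\<^sub>F n in sequentially. \<forall>q \<le> nat \<lfloor>2 powr sqrt (log 2 (real n))\<rfloor> ^ 4
      * (2 * ((nat \<lfloor>2 powr sqrt (log 2 (real n))\<rfloor> ^ 2 + 1) ^ l + 1)
        + nat \<lfloor>2 powr sqrt (log 2 (real n))\<rfloor> ^ 2). q \<le> n ^ 1"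
proof -
  have "\<forall>\<^sub>F n :: nat in sequentially.
      (2 ^ Suc l + 3) * (2 powr sqrt (log 2 (real n))) powr real (2 * l + 6) \<le> real n"
    by real_asymp
  then show ?thesis using eventually_ge_at_top[of 1]
  proof eventually_elim
    case (elim n)
    define y where "y = 2 powr sqrt (log 2 (real n))"
    define x where "x = nat \<lfloor>y\<rfloor>"
    have "1 \<le> y" using elim(2) by (simp add: y_def ge_one_powr_ge_zero)
    have "0 < x" using \<open>1 \<le> y\<close> by (simp add: x_def)
    then have "1 \<le> real x" by simp
    moreover have "real x \<le> y" unfolding x_def using \<open>1 \<le> y\<close> by linarith
    ultimately have x: "1 \<le> real x" "real x \<le> y" by simp_all
    have "real (x ^ 4 * (2 * ((x ^ 2 + 1) ^ l + 1) + x ^ 2))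
        = real x ^ 4 * (2 * ((real x ^ 2 + 1) ^ l + 1) + real x ^ 2)"
      by (simp only: of_nat_mult of_nat_add of_nat_power of_nat_1 of_nat_numeral)
    also have "\<dots> \<le> y ^ 4 * (2 * ((y ^ 2 + y ^ 2) ^ l + 1) + y ^ 2)"
      using x \<open>1 \<le> y\<close> by (intro mult_mono add_mono power_mono) (auto simp: one_le_power)
    also have "\<dots> \<le> y ^ 4 * (2 * (2 ^ l * y ^ (2 * l + 2) + y ^ (2 * l + 2)) + y ^ (2 * l + 2))"
    proof -
      have "(y ^ 2 + y ^ 2) ^ l = (2 * y ^ 2) ^ l" by simp
      also have "\<dots> = 2 ^ l * y ^ (2 * l)" by (simp only: power_mult_distrib power_mult)
      also have "\<dots> \<le> 2 ^ l * y ^ (2 * l + 2)"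
        using \<open>1 \<le> y\<close> by (intro mult_left_mono power_increasing) auto
      finally have "(y ^ 2 + y ^ 2) ^ l \<le> 2 ^ l * y ^ (2 * l + 2)" .
      moreover have "1 \<le> y ^ (2 * l + 2)" using \<open>1 \<le> y\<close> by (rule one_le_power)
      moreover have "y ^ 2 \<le> y ^ (2 * l + 2)" using \<open>1 \<le> y\<close> by (intro power_increasing) auto
      ultimately show ?thesis using \<open>1 \<le> y\<close> by (intro mult_left_mono add_mono) auto
    qed
    also have "\<dots> = (2 ^ Suc l + 3) * y ^ (2 * l + 6)"
    proof -
      have "2 * l + 6 = 4 + (2 * l + 2)" by simp
      then have "y ^ (2 * l + 6) = y ^ 4 * y ^ (2 * l + 2)" by (simp only: power_add)
      then show ?thesis by (simp add: algebra_simps)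
    qed
    also have "\<dots> = (2 ^ Suc l + 3) * y powr real (2 * l + 6)"
      using \<open>1 \<le> y\<close> by (subst powr_realpow) auto
    also have "\<dots> \<le> real n" using elim(1) by (simp add: y_def)
    finally have "x ^ 4 * (2 * ((x ^ 2 + 1) ^ l + 1) + x ^ 2) \<le> n" unfolding of_nat_le_iff .
    then show ?case unfolding x_def y_def by auto
  qed
qed

section \<open>The two growth rates of \<open>\<kappa>\<close>\<close>

theorem theorem2:
  shows "(\<forall>\<epsilon>::real. \<epsilon> > 0 \<longrightarrow>
           (\<exists>k :: nat \<Rightarrow> nat. \<forall>(c::nat) (\<delta>::real). 0 \<le> \<delta> \<and> \<delta> < 1 \<longrightarrow>
              (\<forall>\<^sub>F n in sequentially. \<forall>D :: nat set pmf. set_pmf D \<subseteq> Pow (ground n) \<longrightarrow>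
                 (\<forall>m \<le> n ^ c. \<not> optimizable_from_samples n (coverage_functions n) D (k n)
                                   (real n powr (-1/5 + \<epsilon>)) m \<delta>))))
       \<and>
       (\<exists>(c0::real) (d::nat) (k :: nat \<Rightarrow> nat). c0 > 0 \<and>
           (\<forall>(c::nat) (\<delta>::real). 0 \<le> \<delta> \<and> \<delta> < 1 \<longrightarrow>
              (\<forall>\<^sub>F n in sequentially. \<forall>D :: nat set pmf. set_pmf D \<subseteq> Pow (ground n) \<longrightarrow>
                 (\<forall>m \<le> n ^ c. \<not> optimizable_from_samples n (poly_coverage_functions d n) D (k n)
                                   (2 powr (- c0 * sqrt (log 2 (real n)))) m \<delta>))))"
proof (intro conjI allI impI)
  fix \<epsilon> :: real
  assume "\<epsilon> > 0"
  \<comment> \<open>With \<open>a < \<epsilon>\<close> the product of \<open>\<alpha>\<close> and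
    \<open>\<kappa>\<close>, of order \<open>n powr (\<epsilon> - a)\<close>, is unbounded;
    \<open>a < 1 / 5\<close> makes \<open>\<kappa>\<close> grow, so that rounding is
    harmless.\<close>
  define a where "a = min (\<epsilon> / 2) (1 / 10)"
  have a: "0 < a" "a < \<epsilon>" "a < 1 / 5" using \<open>\<epsilon> > 0\<close> by (auto simp: a_def min_def)
  define \<kappa> where "\<kappa> n = nat \<lfloor>real n powr (1 / 5 - a)\<rfloor>" for n :: nat
  have "\<forall>\<^sub>F n in sequentially. \<forall>D :: nat set pmf. set_pmf D \<subseteq> Pow (ground n) \<longrightarrow>
     (\<forall>m \<le> n ^ c. \<not> optimizable_from_samples n (coverage_functions n) D (\<kappa> n ^ 2)
         (real n powr (-1/5 + \<epsilon>)) m \<delta>)" if "\<delta> < 1" for c \<delta>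
    unfolding coverage_functions_def
  proof (rule eventually_not_optimizable[OF a(1)])
    show "\<forall>\<^sub>F n in sequentially. real (\<kappa> n) \<le> real n powr (1 / 5 - a)"
      by (simp add: \<kappa>_def)
    show "filterlim (\<lambda>n. real n powr (-1/5 + \<epsilon>) * real (\<kappa> n)) at_top sequentially"
      unfolding \<kappa>_def using a by real_asymp
  qed (use that in auto)
  then show "\<exists>k :: nat \<Rightarrow> nat. \<forall>(c::nat) (\<delta>::real). 0 \<le> \<delta> \<and> \<delta> < 1 \<longrightarrow>
      (\<forall>\<^sub>F n in sequentially. \<forall>D :: nat set pmf. set_pmf D \<subseteq> Pow (ground n) \<longrightarrow>
         (\<forall>m \<le> n ^ c. \<not> optimizable_from_samples n (coverage_functions n) D (k n)
                           (real n powr (-1/5 + \<epsilon>)) m \<delta>))"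
    by (intro exI[of _ "\<lambda>n. \<kappa> n ^ 2"]) simp
next
  \<comment> \<open>Slow enough for a universe of size \<open>n\<close>, yet the product with
    \<open>\<alpha>\<close> for \<open>c0 = 1 / 2\<close> still grows like
    \<open>2 powr (sqrt (log 2 n) / 2)\<close>.\<close>
  define \<kappa> where "\<kappa> n = nat \<lfloor>2 powr sqrt (log 2 (real n))\<rfloor>" for n :: nat
  have "\<forall>\<^sub>F n in sequentially. \<forall>D :: nat set pmf. set_pmf D \<subseteq> Pow (ground n) \<longrightarrow>
     (\<forall>m \<le> n ^ c. \<not> optimizable_from_samples n (poly_coverage_functions 1 n) D (\<kappa> n ^ 2)
         (2 powr (- (1 / 2) * sqrt (log 2 (real n)))) m \<delta>)" if "\<delta> < 1" for c \<delta>
    unfolding poly_coverage_functions_def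
  proof (rule eventually_not_optimizable[where a = "1 / 10"])
    show "\<forall>\<^sub>F n in sequentially. real (\<kappa> n) \<le> real n powr (1 / 5 - 1 / 10)"
      unfolding \<kappa>_def by real_asymp
    show "filterlim (\<lambda>n. 2 powr (- (1 / 2) * sqrt (log 2 (real n))) * real (\<kappa> n)) at_top sequentially"
      unfolding \<kappa>_def by real_asymp
    show "\<forall>\<^sub>F n in sequentially. \<forall>q \<le> \<kappa> n ^ 4 * (2 * ((\<kappa> n ^ 2 + 1) ^ l + 1) + \<kappa> n ^ 2). q \<le> n ^ 1" for l
      unfolding \<kappa>_def by (rule eventually_universe_size_le)
  qed (use that in auto)
  then show "\<exists>(c0::real) (d::nat) (k :: nat \<Rightarrow> nat). c0 > 0 \<and>
      (\<forall>(c::nat) (\<delta>::real). 0 \<le> \<delta> \<and> \<delta> < 1 \<longrightarrow>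
        (\<forall>\<^sub>F n in sequentially. \<forall>D :: nat set pmf. set_pmf D \<subseteq> Pow (ground n) \<longrightarrow>
           (\<forall>m \<le> n ^ c. \<not> optimizable_from_samples n (poly_coverage_functions d n) D (k n)
                             (2 powr (- c0 * sqrt (log 2 (real n)))) m \<delta>)))"
    by (intro exI[of _ "1 / 2 :: real"] exI[of _ "1 :: nat"] exI[of _ "\<lambda>n. \<kappa> n ^ 2"]) simp
qed

end
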